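(* Let $G=(V,E)$ be a finite connected multi-graph, let $\mathcal{H}$ be any Schrödinger operator on $G$, and let $\mathcal{H}^{\mathrm{ab}}$ be its pull-back to the maximal abelian cover $G^{\mathrm{ab}}$, acting on $\ell^2(V_{G^{\mathrm{ab}}})$. If $G$ is regular, then $\mathcal{H}^{\mathrm{ab}}$ has no eigenvalues.
   Context: Multi-graphs may have self-loops and multiple edges; a self-loop contributes $2$ to the degree of its vertex. $G$ is regular if all its vertices have the same degree. $\vec{E}$ is the set of directed edges: every $e\in E$ (including each self-loop) appears in $\vec E$ with both orientations. For $e\in\vec E$, $o(e)$ and $t(e)$ are its origin and terminus and $e^{-1}$ is the same edge with the opposite orientation. A Schrödinger operator on a finite multi-graph $G$ is an operator $\mathcal{H}:\ell^2(V)\to\ell^2(V)$ with matrix entries $\mathcal{H}_{uv}=\sum_{e\in\vec E:\,o(e)=u,\,t(e)=v}w_e+\delta_{uv}\mathcal{V}_v$, where $w_e\in\mathbb{C}$, $w_e=\overline{w_{e^{-1}}}\neq 0$ and $\mathcal{V}_v\in\mathbb{R}$. The maximal abelian cover of $G$ is $G^{\mathrm{ab}}=\tilde G/[\pi_1(G),\pi_1(G)]$, where $\tilde G$ is the universal cover of $G$ and $\pi_1(G)$ acts on $\tilde G$ by deck transformations; equivalently it is the maximal connected Galois cover of $G$ with abelian deck group. $\mathcal{H}^{\mathrm{ab}}$ is the Schrödinger operator on $\ell^2(V_{G^{\mathrm{ab}}})$ whose edge weights and vertex potentials are the pull-backs of those of $\mathcal{H}$ along the covering map. An eigenvalue of $\mathcal{H}^{\mathrm{ab}}$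 is a $\lambda$ for which there is a nonzero $f\in\ell^2(V_{G^{\mathrm{ab}}})$ with $\mathcal{H}^{\mathrm{ab}}f=\lambda f$.
   Formalization: The formal theorem additionally assumes that every vertex has degree at least 2; this excludes exactly the single vertex without edges and the single edge K_2, whose maximal abelian cover is finite, so that the operator does have eigenvalues there. *)

theory Defs
  imports
    "HOL-Analysis.Infinite_Sum"
    "HOL-Algebra.Group_Action"
    "HOL-Algebra.Generated_Groups"
    "Graph_Theory.Graph_Theory"
begin

text \<open>
  A multi-graph is a \<^locale>\<open>bidirected_digraph\<close>: the arcs are the oriented edges, and
  the fixed-point free involution \<open>r\<close> reverses the orientation.  A self-loop thus consists of
  two distinct arcs and adds 2 to \<^const>\<open>out_degree\<close>, which is the degree.
\<close>

definition regular_multigraph :: "('v, 'e) pre_digraph \<Rightarrow> bool" where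
  "regular_multigraph G \<longleftrightarrow> (\<exists>d. \<forall>v\<in>verts G. out_degree G v = d)"

section \<open>Schroedinger operators\<close>

definition schroedinger_weights :: "('v, 'e) pre_digraph \<Rightarrow> ('e \<Rightarrow> 'e) \<Rightarrow> ('e \<Rightarrow> complex) \<Rightarrow> bool" where
  "schroedinger_weights G r w \<longleftrightarrow> (\<forall>e\<in>arcs G. w e = cnj (w (r e)) \<and> w e \<noteq> 0)"

definition schroedinger_entry ::
    "('v, 'e) pre_digraph \<Rightarrow> ('e \<Rightarrow> complex) \<Rightarrow> ('v \<Rightarrow> real) \<Rightarrow> 'v \<Rightarrow> 'v \<Rightarrow> complex" where
  "schroedinger_entry G w q u v =
     (\<Sum>e | e \<in> arcs G \<and> tail G e = u \<and> head G e = v. w e) + (if u = v then of_real (q v) else 0)"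

text \<open>On a locally finite graph every row of the matrix has finite support, so the infinite sum
  below always converges.\<close>

definition schroedinger_op ::
    "('v, 'e) pre_digraph \<Rightarrow> ('e \<Rightarrow> complex) \<Rightarrow> ('v \<Rightarrow> real) \<Rightarrow> ('v \<Rightarrow> complex) \<Rightarrow> 'v \<Rightarrow> complex" where
  "schroedinger_op G w q f u = (\<Sum>\<^sub>\<infinity>v\<in>verts G. schroedinger_entry G w q u v * f v)"

text \<open>Elements of \<open>\<ell>\<^sup>2(X)\<close> are represented by functions on the whole type whose values
  outside \<open>X\<close> are irrelevant.\<close>

definition square_summable_on :: "('x \<Rightarrow> complex) \<Rightarrow> 'x set \<Rightarrow> bool" where
  "square_summable_on f X \<longleftrightarrow> (\<lambda>x. (cmod (f x))\<^sup>2) summable_on X"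

definition l2_eigenvalue :: "'x set \<Rightarrow> (('x \<Rightarrow> complex) \<Rightarrow> 'x \<Rightarrow> complex) \<Rightarrow> complex \<Rightarrow> bool" where
  "l2_eigenvalue X T l \<longleftrightarrow>
     (\<exists>f. square_summable_on f X \<and> (\<exists>x\<in>X. f x \<noteq> 0) \<and> (\<forall>x\<in>X. T f x = l * f x))"

section \<open>Reduced walks and the fundamental group\<close>

definition reduced :: "('e \<Rightarrow> 'e) \<Rightarrow> 'e list \<Rightarrow> bool" where
  "reduced r p \<longleftrightarrow> successively (\<lambda>a b. b \<noteq> r a) p"

definition cancel_cons :: "('e \<Rightarrow> 'e) \<Rightarrow> 'e \<Rightarrow> 'e list \<Rightarrow> 'e list" where
  "cancel_cons r a p = (case p of [] \<Rightarrow> [a] | b # q \<Rightarrow> if b = r a then q else a # p)"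

definition reduce :: "('e \<Rightarrow> 'e) \<Rightarrow> 'e list \<Rightarrow> 'e list" where
  "reduce r p = foldr (cancel_cons r) p []"

definition reduced_walks :: "('v, 'e) pre_digraph \<Rightarrow> ('e \<Rightarrow> 'e) \<Rightarrow> 'v \<Rightarrow> 'v \<Rightarrow> 'e list set" where
  "reduced_walks G r u v = {p. pre_digraph.awalk G u p v \<and> reduced r p}"

text \<open>Each homotopy class of walks (with fixed endpoints) contains exactly one reduced walk, by
  which it is represented.\<close>

definition fundamental_group :: "('v, 'e) pre_digraph \<Rightarrow> ('e \<Rightarrow> 'e) \<Rightarrow> 'v \<Rightarrow> 'e list monoid" where
  "fundamental_group G r u =
     \<lparr>carrier = reduced_walks G r u u, mult = (\<lambda>p q. reduce r (p @ q)), one = []\<rparr>"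

section \<open>The universal cover and the maximal abelian cover\<close>

text \<open>The vertices of the universal cover are the reduced walks \<open>p\<close> starting at the base point;
  the arc \<open>(p, a)\<close> is the lift of the arc \<open>a\<close> starting at \<open>p\<close>.  The covering map sends \<open>p\<close>
  to its final vertex and \<open>(p, a)\<close> to \<open>a\<close>.\<close>

definition universal_cover ::
    "('v, 'e) pre_digraph \<Rightarrow> ('e \<Rightarrow> 'e) \<Rightarrow> 'v \<Rightarrow> ('e list, 'e list \<times> 'e) pre_digraph" where
  "universal_cover G r u =
     \<lparr>verts = (\<Union>v\<in>verts G. reduced_walks G r u v),
      arcs = (\<Union>v\<in>verts G. reduced_walks G r u v \<times> out_arcs G v),
      tail = fst,
      head = (\<lambda>(p, a). reduce r (p @ [a]))\<rparr>"

definition deck_vert :: "('e \<Rightarrow> 'e) \<Rightarrow> 'e list \<Rightarrow> 'e list \<Rightarrow> 'e list" where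
  "deck_vert r g p = reduce r (g @ p)"

definition deck_arc :: "('e \<Rightarrow> 'e) \<Rightarrow> 'e list \<Rightarrow> 'e list \<times> 'e \<Rightarrow> 'e list \<times> 'e" where
  "deck_arc r g = map_prod (deck_vert r g) id"

text \<open>Tail and head are equivariant, so they map an orbit of arcs onto an orbit of vertices.\<close>

definition quotient_graph ::
    "('g, 'm) monoid_scheme \<Rightarrow> ('g \<Rightarrow> 'x \<Rightarrow> 'x) \<Rightarrow> ('g \<Rightarrow> 'y \<Rightarrow> 'y) \<Rightarrow> ('x, 'y) pre_digraph
      \<Rightarrow> ('x set, 'y set) pre_digraph" where
  "quotient_graph K \<phi> \<psi> T =
     \<lparr>verts = orbits K (verts T) \<phi>,
      arcs = orbits K (arcs T) \<psi>,
      tail = (\<lambda>A. tail T ` A),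
      head = (\<lambda>A. head T ` A)\<rparr>"

definition commutator_subgroup :: "('g, 'm) monoid_scheme \<Rightarrow> ('g, 'm) monoid_scheme" where
  "commutator_subgroup K = K\<lparr>carrier := derived K (carrier K)\<rparr>"

definition max_abelian_cover ::
    "('v, 'e) pre_digraph \<Rightarrow> ('e \<Rightarrow> 'e) \<Rightarrow> 'v \<Rightarrow> ('e list set, ('e list \<times> 'e) set) pre_digraph" where
  "max_abelian_cover G r u =
     quotient_graph (commutator_subgroup (fundamental_group G r u)) (deck_vert r) (deck_arc r)
       (universal_cover G r u)"

text \<open>The covering map from the maximal abelian cover: all elements of an orbit have the same
  image under the covering map of the universal cover.\<close>

definition ab_proj_vert :: "('v, 'e) pre_digraph \<Rightarrow> 'v \<Rightarrow> 'e list set \<Rightarrow> 'v" where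
  "ab_proj_vert G u X = the_elem (pre_digraph.awlast G u ` X)"

definition ab_proj_arc :: "('e list \<times> 'e) set \<Rightarrow> 'e" where
  "ab_proj_arc A = the_elem (snd ` A)"

definition schroedinger_ab ::
    "('v, 'e) pre_digraph \<Rightarrow> ('e \<Rightarrow> 'e) \<Rightarrow> 'v \<Rightarrow> ('e \<Rightarrow> complex) \<Rightarrow> ('v \<Rightarrow> real)
      \<Rightarrow> ('e list set \<Rightarrow> complex) \<Rightarrow> 'e list set \<Rightarrow> complex" where
  "schroedinger_ab G r u w q =
     schroedinger_op (max_abelian_cover G r u) (w \<circ> ab_proj_arc) (q \<circ> ab_proj_vert G u)"

end

theory Submission
  imports Defs
    "HOL-Library.Poly_Mapping"
    "HOL-Computational_Algebra.Polynomial_Factorial"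
    "HOL-Analysis.Convex"
begin

text \<open>
  Give every edge of \<open>G\<close> its own variable \<open>z\<close> and replace the weight of an arc \<open>a\<close> by
  \<open>w a * z\<close> or \<open>w a * z\<^sup>-\<^sup>1\<close>, according to its orientation.  This turns the
  operator into a Hermitian matrix over the ring of Laurent polynomials, with the conjugation that
  sends \<open>z\<close> to \<open>z\<^sup>-\<^sup>1\<close>.  The proof has an algebraic half (this matrix minus \<open>l\<close> has no
  kernel when \<open>G\<close> is regular) and an analytic half (a square-summable eigenfunction on the
  cover would force such a kernel).

  For the algebraic half, absorb a real \<open>l\<close> into the potential, and let \<open>f \<noteq> 0\<close> be a kernel
  vector and \<open>X\<close> its support.  Differentiating \<open>H f = 0\<close> in the variable of an edge and pairing with
  \<open>f\<close> shows that no current flows through that edge: \<open>f\<^sup>* W f\<close> along the edge is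
  self-conjugate (\<open>zero_current\<close>).  Its logarithmic derivative then exhibits, for each edge inside
  \<open>X\<close>, a potential on \<open>X\<close> whose difference vanishes along every other inner edge.  So inner edges
  are independent: \<open>X\<close> carries no nonzero flow (\<open>flow_vanishes\<close>), which is to say that it spans a
  forest.  Next, choose for each vertex \<open>b\<close> of the boundary of \<open>X\<close> an edge from \<open>b\<close> into \<open>X\<close>; the
  derivative of \<open>f\<close> in its variable violates the equation at \<open>b\<close> but at no other vertex of \<open>X\<close> or
  its boundary.  Together with \<open>f\<close> itself this gives linearly independent vectors on \<open>X\<close>, one for
  \<open>f\<close>, one per boundary vertex and one per inner edge, so
  \<open>1 + |boundary| + |inner edges| \<le> |X|\<close> (\<open>card_inner_edges_boundary\<close>).  In a \<open>d\<close>-regular graph,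
  counting the arcs that leave vertices of \<open>X\<close> gives
  \<open>d |X| \<le> 2 |inner edges| + d |boundary|\<close>, and for \<open>d \<ge> 2\<close> the two bounds are incompatible.
  For non-real \<open>l\<close> the kernel vanishes because the matrix is Hermitian.

  For the analytic half, a vertex of the maximal abelian cover is determined by the end vertex \<open>v\<close> of a walk
  from the base point and by its chain \<open>c\<close>, the vector of signed edge counts; this rests on the
  fact that closed walks with zero chain make up the commutator subgroup (\<open>derived_pi\<close>).  Hence an
  eigenfunction becomes a square-summable function on pairs \<open>(v, c)\<close>, extended by zero to the whole
  lattice of chains.  Restrict the chains to a box of side \<open>N\<close>.  The equations at interior pairs are
  linearly independent, because a relation between them would be a finitely supported eigenfunction
  of the transposed operator, that is, a kernel vector over the Laurent polynomials.  So the
  solutions on the box form a space of dimension at most the number of boundary pairs, and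
  averaging the diagonal of the projection onto this space over the translates of the eigenfunction
  bounds \<open>|F(v, c)|\<^sup>2\<close> by a multiple of the proportion of boundary pairs
  (\<open>box_estimate\<close>), which tends to zero.
\<close>

section \<open>Laurent polynomials: conjugation and derivations\<close>

text \<open>The exponents are finitely supported integer vectors, one entry for each variable.  Their
  lexicographic order makes this ring an integral domain.\<close>

type_synonym laurent = "(nat \<Rightarrow>\<^sub>0 int) \<Rightarrow>\<^sub>0 complex"

lemma laurent_induct [case_names single add]:
  fixes f :: laurent
  assumes "\<And>m c. P (Poly_Mapping.single m c)"
    and "\<And>f g. P f \<Longrightarrow> P g \<Longrightarrow> P (f + g)"
  shows "P f"
proof (induction f rule: Poly_Mapping.update_induct)
  case const
  show ?case using assms(1)[of 0 0] by simp
next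
  case (update f a b)
  have "Poly_Mapping.update a b f = f + Poly_Mapping.single a b"
    using update(1)
    by (intro poly_mapping_eqI)
      (auto simp: lookup_update lookup_add lookup_single when_def in_keys_iff)
  then show ?case using assms update by metis
qed

text \<open>The conjugation \<open>z \<mapsto> z\<^sup>-\<^sup>1\<close> together with complex conjugation of the coefficients; on the
  torus \<open>|z| = 1\<close> it is pointwise complex conjugation.\<close>

lift_definition laurent_star :: "laurent \<Rightarrow> laurent" is
  "\<lambda>f (m :: nat \<Rightarrow>\<^sub>0 int). cnj (f (- m))"
  subgoal premises prems for f
  proof -
    have "{m. cnj (f (- m)) \<noteq> 0} = uminus ` {m. f m \<noteq> 0}"
      by (auto intro: image_eqI[where x="- m" for m])
    then show ?thesis using prems by simp
  qed
  done

text \<open>The Euler derivation \<open>z\<^sub>i \<partial>/\<partial>z\<^sub>i\<close>, which acts diagonally on monomials.\<close>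

lift_definition laurent_deriv :: "nat \<Rightarrow> laurent \<Rightarrow> laurent" is
  "\<lambda>i f m. of_int (Poly_Mapping.lookup m i) * f m"
  by (rule finite_subset) auto

lemma star_single [simp]:
  "laurent_star (Poly_Mapping.single m c) = Poly_Mapping.single (- m) (cnj c)"
  by (rule poly_mapping_eqI) (auto simp: laurent_star.rep_eq lookup_single when_def)

lemma star_add [simp]: "laurent_star (f + g) = laurent_star f + laurent_star g"
  by (rule poly_mapping_eqI) (simp add: laurent_star.rep_eq lookup_add)

lemma star_zero [simp]: "laurent_star 0 = 0"
  by (rule poly_mapping_eqI) (simp add: laurent_star.rep_eq)

lemma star_sum: "laurent_star (sum f A) = (\<Sum>x\<in>A. laurent_star (f x))"
  by (induction A rule: infinite_finite_induct) auto

lemma star_star [simp]: "laurent_star (laurent_star f) = f"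
  by (rule poly_mapping_eqI) (simp add: laurent_star.rep_eq)

lemma star_eq_0_iff [simp]: "laurent_star f = 0 \<longleftrightarrow> f = 0"
  by (metis star_star star_zero)

lemma star_mult [simp]: "laurent_star (f * g) = laurent_star f * laurent_star g"
proof (induction f rule: laurent_induct)
  case (single m c)
  show ?case
    by (induction g rule: laurent_induct) (simp_all add: mult_single distrib_left)
qed (simp add: distrib_right)

lemma deriv_single:
  "laurent_deriv i (Poly_Mapping.single m c)
     = Poly_Mapping.single m (of_int (Poly_Mapping.lookup m i) * c)"
  by (rule poly_mapping_eqI) (auto simp: laurent_deriv.rep_eq lookup_single when_def)

lemma deriv_single':
  "laurent_deriv i (Poly_Mapping.single m c)
     = of_int (Poly_Mapping.lookup m i) * Poly_Mapping.single m c"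
  by (metis deriv_single single_of_int mult_single add_0)

lemma deriv_add [simp]: "laurent_deriv i (f + g) = laurent_deriv i f + laurent_deriv i g"
  by (rule poly_mapping_eqI) (simp add: laurent_deriv.rep_eq lookup_add algebra_simps)

lemma deriv_zero [simp]: "laurent_deriv i 0 = 0"
  by (rule poly_mapping_eqI) (simp add: laurent_deriv.rep_eq)

lemma deriv_sum: "laurent_deriv i (sum f A) = (\<Sum>x\<in>A. laurent_deriv i (f x))"
  by (induction A rule: infinite_finite_induct) auto

lemma deriv_mult:
  "laurent_deriv i (f * g) = laurent_deriv i f * g + f * laurent_deriv i g"
proof (induction f rule: laurent_induct)
  case (single m c)
  show ?case
    by (induction g rule: laurent_induct)
      (simp_all add: mult_single deriv_single lookup_add algebra_simps flip: single_add)
qed (simp add: algebra_simps)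

text \<open>The constant coefficient of \<open>f\<^sup>* f\<close> is the integral of \<open>|f|\<^sup>2\<close> over the torus; this is
  Parseval's identity.  It makes the sesquilinear pairing of Laurent vectors definite.\<close>

lemma lookup_star_mult_0:
  "Poly_Mapping.lookup (laurent_star f * f) 0
     = of_real (\<Sum>m\<in>Poly_Mapping.keys f. (cmod (Poly_Mapping.lookup f m))\<^sup>2)"
proof -
  have *: "(\<Sum>q. Poly_Mapping.lookup f q when l + q = 0) = Poly_Mapping.lookup f (- l)" for l
  proof -
    have "(\<Sum>q. Poly_Mapping.lookup f q when l + q = 0) = (\<Sum>q. Poly_Mapping.lookup f q when q = - l)"
      by (rule arg_cong[where f=Sum_any]) (auto simp: fun_eq_iff when_def add_eq_0_iff)
    then show ?thesis by simp
  qed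
  have sq: "cnj z * z = of_real ((cmod z)\<^sup>2)" for z
    using complex_norm_square[of z] by (metis mult.commute)
  have "Poly_Mapping.lookup (laurent_star f * f) 0
    = (\<Sum>l. of_real ((cmod (Poly_Mapping.lookup f (- l)))\<^sup>2))"
    unfolding lookup_mult laurent_star.rep_eq
    by (rule arg_cong[where f=Sum_any], rule ext) (simp only: * sq eq_commute[of 0])
  also have "\<dots> = (\<Sum>l\<in>uminus ` Poly_Mapping.keys f. of_real ((cmod (Poly_Mapping.lookup f (- l)))\<^sup>2))"
    by (rule Sum_any.expand_superset) (auto simp: in_keys_iff intro: image_eqI[where x="- m" for m])
  also have "\<dots> = (\<Sum>l\<in>Poly_Mapping.keys f. of_real ((cmod (Poly_Mapping.lookup f l))\<^sup>2))"
    by (subst sum.reindex) (auto simp: inj_on_def)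
  finally show ?thesis by simp
qed

lemma sum_star_mult_eq_0:
  fixes f :: "'a \<Rightarrow> laurent"
  assumes "finite V" "(\<Sum>v\<in>V. laurent_star (f v) * f v) = 0" "v \<in> V"
  shows "f v = 0"
proof -
  define S where "S = (\<Sum>v\<in>V. \<Sum>m\<in>Poly_Mapping.keys (f v). (cmod (Poly_Mapping.lookup (f v) m))\<^sup>2)"
  have "Poly_Mapping.lookup (\<Sum>v\<in>V. laurent_star (f v) * f v) 0 = of_real S"
    unfolding S_def by (simp only: lookup_sum lookup_star_mult_0 of_real_sum)
  then have "S = 0" by (simp only: assms(2) lookup_zero) simp
  then have "(\<Sum>m\<in>Poly_Mapping.keys (f v). (cmod (Poly_Mapping.lookup (f v) m))\<^sup>2) = 0"
    unfolding S_def using assms(1,3)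
    by (subst (asm) sum_nonneg_eq_0_iff) (auto intro!: sum_nonneg)
  then show ?thesis
    by (subst (asm) sum_nonneg_eq_0_iff) (auto simp: in_keys_iff intro!: poly_mapping_eqI)
qed

definition log_deriv :: "nat \<Rightarrow> laurent \<Rightarrow> laurent fract" where
  "log_deriv i f = to_fract (laurent_deriv i f) / to_fract f"

lemma log_deriv_mult:
  "f \<noteq> 0 \<Longrightarrow> g \<noteq> 0 \<Longrightarrow> log_deriv i (f * g) = log_deriv i f + log_deriv i g"
  by (simp add: log_deriv_def deriv_mult field_simps)

lemma single_eq_0_iff: "Poly_Mapping.single m c = 0 \<longleftrightarrow> c = 0"
  by (metis lookup_single_eq lookup_zero single_zero)

lemma to_fract_of_int: "to_fract (of_int n) = of_int n"
proof -
  have *: "to_fract (of_nat k) = of_nat k" for k by (induction k) auto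
  show ?thesis by (cases n) (simp_all only: of_int_of_nat_eq of_int_minus to_fract_uminus *)
qed

lemma log_deriv_single:
  "c \<noteq> 0 \<Longrightarrow> log_deriv i (Poly_Mapping.single m c) = of_int (Poly_Mapping.lookup m i)"
  by (simp add: log_deriv_def deriv_single' to_fract_of_int single_eq_0_iff)

lemma to_fract_sum: "to_fract (sum f A) = (\<Sum>x\<in>A. to_fract (f x))"
  by (induction A rule: infinite_finite_induct) auto

section \<open>Two facts from linear algebra\<close>

text \<open>Gaussian elimination: more vectors than coordinates are linearly dependent.\<close>

lemma nontrivial_linear_relation:
  fixes M :: "'i \<Rightarrow> 'x \<Rightarrow> 'k::field"
  assumes "finite X" "finite I" "card X < card I"
  shows "\<exists>c. (\<exists>i\<in>I. c i \<noteq> 0) \<and> (\<forall>x\<in>X. (\<Sum>i\<in>I. c i * M i x) = 0)"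
  using assms
proof (induction X arbitrary: I M rule: finite_induct)
  case empty
  then have "I \<noteq> {}" by auto
  then show ?case by (auto intro!: exI[of _ "\<lambda>_. 1"])
next
  case (insert x X)
  show ?case
  proof (cases "\<forall>i\<in>I. M i x = 0")
    case True
    obtain c where "\<exists>i\<in>I. c i \<noteq> 0" "\<forall>x\<in>X. (\<Sum>i\<in>I. c i * M i x) = 0"
      using insert.IH[OF insert.prems(1), of M] insert.prems(2) insert.hyps
      by (metis Suc_lessD card_insert_disjoint)
    then show ?thesis using True by (intro exI[of _ c]) auto
  next
    case False
    then obtain j where j: "j \<in> I" "M j x \<noteq> 0" by blast
    \<comment> \<open>eliminate the coordinate \<open>x\<close> with the pivot \<open>j\<close>\<close>
    define N where "N i y = M i y - M i x / M j x * M j y" for i y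
    have "card X < card (I - {j})" using insert j by simp
    then obtain c where c: "\<exists>i\<in>I-{j}. c i \<noteq> 0" "\<forall>y\<in>X. (\<Sum>i\<in>I-{j}. c i * N i y) = 0"
      using insert.IH[of "I - {j}" N] insert.prems by auto
    define d where "d = c(j := - (\<Sum>i\<in>I-{j}. c i * M i x) / M j x)"
    have "(\<Sum>i\<in>I. d i * M i y) = (\<Sum>i\<in>I-{j}. c i * N i y)" for y
    proof -
      have "(\<Sum>i\<in>I. d i * M i y) = d j * M j y + (\<Sum>i\<in>I-{j}. d i * M i y)"
        using j insert.prems by (simp add: sum.remove)
      also have "(\<Sum>i\<in>I-{j}. d i * M i y) = (\<Sum>i\<in>I-{j}. c i * M i y)"
        by (rule sum.cong) (auto simp: d_def)
      also have "d j * M j y + \<dots>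
          = (\<Sum>i\<in>I-{j}. c i * M i y) - (\<Sum>i\<in>I-{j}. c i * M i x * (M j y / M j x))"
        unfolding sum_distrib_right[symmetric] by (simp add: d_def)
      also have "\<dots> = (\<Sum>i\<in>I-{j}. c i * N i y)"
        unfolding sum_subtractf[symmetric] by (rule sum.cong) (simp_all add: N_def right_diff_distrib)
      finally show ?thesis .
    qed
    then have "(\<Sum>i\<in>I. d i * M i y) = 0" if "y \<in> insert x X" for y
      using that c(2) j by (auto simp: N_def)
    moreover have "\<exists>i\<in>I. d i \<noteq> 0" using c(1) by (auto simp: d_def)
    ultimately show ?thesis by blast
  qed
qed

lemma cauchy_schwarz_complex:
  fixes f g :: "'a \<Rightarrow> complex"
  shows "(cmod (\<Sum>x\<in>A. f x * g x))\<^sup>2 \<le> (\<Sum>x\<in>A. (cmod (f x))\<^sup>2) * (\<Sum>x\<in>A. (cmod (g x))\<^sup>2)"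
proof -
  have "cmod (\<Sum>x\<in>A. f x * g x) \<le> (\<Sum>x\<in>A. cmod (f x) * cmod (g x))"
    using norm_sum[of "\<lambda>x. f x * g x" A] by (simp add: norm_mult)
  then have "(cmod (\<Sum>x\<in>A. f x * g x))\<^sup>2 \<le> (\<Sum>x\<in>A. cmod (f x) * cmod (g x))\<^sup>2"
    by (intro power_mono) auto
  also have "\<dots> \<le> (\<Sum>x\<in>A. (cmod (f x))\<^sup>2) * (\<Sum>x\<in>A. (cmod (g x))\<^sup>2)"
    by (rule Cauchy_Schwarz_ineq_sum)
  finally show ?thesis .
qed

text \<open>\<open>Q\<close> is the matrix of the orthogonal projection of \<open>\<complex>\<^sup>T\<close> onto the space of solutions of the
  equations \<open>K x\<close>, \<open>x \<in> J\<close>.  The fourth clause says that \<open>1 - Q\<close> has its rows in the span of the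
  equations; it is what allows an induction on \<open>J\<close>.\<close>

definition projects_onto_kernel ::
    "('x \<Rightarrow> 'y \<Rightarrow> complex) \<Rightarrow> 'x set \<Rightarrow> 'y set \<Rightarrow> ('y \<Rightarrow> 'y \<Rightarrow> complex) \<Rightarrow> bool" where
  "projects_onto_kernel K J T Q \<longleftrightarrow>
     (\<forall>y z. Q y z = cnj (Q z y))
    \<and> (\<forall>y\<in>T. \<forall>z\<in>T. (\<Sum>t\<in>T. Q y t * Q t z) = Q y z)
    \<and> (\<Sum>y\<in>T. Q y y) = of_nat (card T) - of_nat (card J)
    \<and> (\<forall>y\<in>T. \<exists>c. \<forall>z\<in>T. (if y = z then 1 else 0) - Q y z = (\<Sum>x\<in>J. c x * K x z))
    \<and> (\<forall>F. (\<forall>x\<in>J. (\<Sum>y\<in>T. K x y * F y) = 0) \<longrightarrow> (\<forall>y\<in>T. (\<Sum>z\<in>T. Q y z * F z) = F y))"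

lemma projects_onto_kernelD:
  assumes "projects_onto_kernel K J T Q"
  shows "Q y z = cnj (Q z y)"
    and "y \<in> T \<Longrightarrow> z \<in> T \<Longrightarrow> (\<Sum>t\<in>T. Q y t * Q t z) = Q y z"
    and "(\<Sum>y\<in>T. Q y y) = of_nat (card T) - of_nat (card J)"
    and "\<forall>y\<in>T. \<exists>c. \<forall>z\<in>T. (if y = z then 1 else 0) - Q y z = (\<Sum>x\<in>J. c x * K x z)"
    and "\<forall>x\<in>J. (\<Sum>y\<in>T. K x y * F y) = 0 \<Longrightarrow> y \<in> T \<Longrightarrow> (\<Sum>z\<in>T. Q y z * F z) = F y"
  using assms unfolding projects_onto_kernel_def by blast+

text \<open>Gram-Schmidt: a new equation is projected to the solution space of the old ones, giving a vector
  \<open>u\<close>, which is nonzero by independence; the rank-one projection onto \<open>u\<close> is then subtracted from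
  \<open>Q\<close>.\<close>

lemma projection_onto_kernel_exists:
  fixes K :: "'x \<Rightarrow> 'y \<Rightarrow> complex"
  assumes "finite J" "finite T"
    and indep: "\<forall>g. (\<forall>y\<in>T. (\<Sum>x\<in>J. g x * K x y) = 0) \<longrightarrow> (\<forall>x\<in>J. g x = 0)"
  shows "\<exists>Q. projects_onto_kernel K J T Q"
  using assms(1) indep
proof (induction J rule: finite_induct)
  case empty
  show ?case
    using \<open>finite T\<close>
    by (intro exI[of _ "\<lambda>y z. if y = z then 1 else 0"])
      (auto simp: projects_onto_kernel_def if_distrib[where f="\<lambda>x. x * _"] sum.delta sum.delta' cong: if_cong)
next
  case (insert j J)
  have indep_J: "\<forall>g. (\<forall>y\<in>T. (\<Sum>x\<in>J. g x * K x y) = 0) \<longrightarrow> (\<forall>x\<in>J. g x = 0)"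
  proof (intro allI impI ballI)
    fix g x assume g: "\<forall>y\<in>T. (\<Sum>x\<in>J. g x * K x y) = 0" and x: "x \<in> J"
    have "(\<Sum>x\<in>insert j J. (g(j := 0)) x * K x y) = (\<Sum>x\<in>J. g x * K x y)" for y
      using insert.hyps by (auto intro!: sum.cong)
    then have "(g(j := 0)) x = 0"
      using insert.prems[THEN spec, of "g(j := 0)"] g x by (simp only:) blast
    then show "g x = 0" using x insert.hyps by (auto split: if_splits)
  qed
  obtain Q where Q: "projects_onto_kernel K J T Q"
    using insert.IH[OF indep_J] by blast
  note herm = projects_onto_kernelD(1)[OF Q] and idem = projects_onto_kernelD(2)[OF Q]
    and tr = projects_onto_kernelD(3)[OF Q] and span = projects_onto_kernelD(4)[OF Q]
    and fixed = projects_onto_kernelD(5)[OF Q]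
  obtain c where "\<forall>y\<in>T. \<forall>z\<in>T. (if y = z then 1 else 0) - Q y z = (\<Sum>x\<in>J. c y x * K x z)"
    using bchoice[OF span] by (elim exE)
  note c = this[rule_format]
  define u where "u y = (\<Sum>z\<in>T. Q y z * cnj (K j z))" for y
  have cnj_u: "cnj (u z) = (\<Sum>t\<in>T. K j t * Q t z)" for z
    unfolding u_def cnj_sum by (rule sum.cong) (simp_all add: herm[of z] mult.commute)
  have row: "K j z - cnj (u z) = (\<Sum>x\<in>J. (\<Sum>t\<in>T. K j t * c t x) * K x z)" if "z \<in> T" for z
  proof -
    have "K j z - cnj (u z) = (\<Sum>t\<in>T. K j t * ((if t = z then 1 else 0) - Q t z))"
      using that \<open>finite T\<close>
      by (simp add: cnj_u right_diff_distrib sum_subtractf if_distrib[where f="\<lambda>x. _ * x"] cong: if_cong)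
    also have "\<dots> = (\<Sum>t\<in>T. K j t * (\<Sum>x\<in>J. c t x * K x z))"
      using c that by (intro sum.cong) auto
    also have "\<dots> = (\<Sum>x\<in>J. (\<Sum>t\<in>T. K j t * c t x) * K x z)"
      unfolding sum_distrib_left sum_distrib_right by (subst sum.swap) (simp add: mult.assoc)
    finally show ?thesis .
  qed
  define N where "N = (\<Sum>y\<in>T. u y * cnj (u y))"
  have N_real: "N = of_real (\<Sum>y\<in>T. (cmod (u y))\<^sup>2)"
    by (simp add: N_def complex_norm_square del: of_real_power)
  \<comment> \<open>otherwise \<open>row\<close> writes the equation \<open>K j\<close> as a combination of the others\<close>
  have "\<exists>y\<in>T. u y \<noteq> 0"
  proof (rule ccontr)
    assume "\<not> (\<exists>y\<in>T. u y \<noteq> 0)"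
    then have u0: "K j z = (\<Sum>x\<in>J. (\<Sum>t\<in>T. K j t * c t x) * K x z)" if "z \<in> T" for z
      using row[OF that] that by simp
    define g where "g x = (if x = j then 1 else - (\<Sum>t\<in>T. K j t * c t x))" for x
    have "(\<Sum>x\<in>insert j J. g x * K x y) = 0" if "y \<in> T" for y
    proof -
      have "(\<Sum>x\<in>J. g x * K x y) = - (\<Sum>x\<in>J. (\<Sum>t\<in>T. K j t * c t x) * K x y)"
        unfolding sum_negf[symmetric] using insert.hyps by (intro sum.cong) (auto simp: g_def)
      then show ?thesis using insert.hyps u0[OF that] by (simp add: g_def)
    qed
    then have "g j = 0" using insert.prems by blast
    then show False by (simp add: g_def)
  qed
  then have N: "N \<noteq> 0"
    unfolding N_real of_real_eq_0_iff using \<open>finite T\<close> by (subst sum_nonneg_eq_0_iff) auto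
  have N_cnj: "cnj N = N" by (simp add: N_real)
  have Qu: "(\<Sum>t\<in>T. Q y t * u t) = u y" if "y \<in> T" for y
  proof -
    have "(\<Sum>t\<in>T. Q y t * u t) = (\<Sum>z\<in>T. (\<Sum>t\<in>T. Q y t * Q t z) * cnj (K j z))"
      unfolding u_def sum_distrib_left sum_distrib_right by (subst sum.swap) (simp add: mult.assoc)
    also have "\<dots> = u y" unfolding u_def by (rule sum.cong) (simp_all add: idem that)
    finally show ?thesis .
  qed
  have uQ: "(\<Sum>t\<in>T. cnj (u t) * Q t z) = cnj (u z)" if "z \<in> T" for z
  proof -
    have "(\<Sum>t\<in>T. cnj (u t) * Q t z) = cnj (\<Sum>t\<in>T. Q z t * u t)"
      unfolding cnj_sum by (rule sum.cong) (simp_all add: herm[of z] mult.commute)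
    then show ?thesis using Qu[OF that] by simp
  qed
  define R where "R y z = Q y z - u y * cnj (u z) / N" for y z
  have "projects_onto_kernel K (insert j J) T R"
    unfolding projects_onto_kernel_def
  proof (intro conjI ballI allI impI)
    show "R y z = cnj (R z y)" for y z
      by (simp add: R_def herm[of y z] N_cnj mult.commute)
  next
    fix y z assume yz: "y \<in> T" "z \<in> T"
    have "(\<Sum>t\<in>T. R y t * R t z)
        = (\<Sum>t\<in>T. Q y t * Q t z - Q y t * u t * (cnj (u z) / N)
            - u y / N * (cnj (u t) * Q t z) + u y * cnj (u z) / N\<^sup>2 * (u t * cnj (u t)))"
      by (rule sum.cong) (simp_all add: R_def algebra_simps power2_eq_square)
    also have "\<dots> = (\<Sum>t\<in>T. Q y t * Q t z) - (\<Sum>t\<in>T. Q y t * u t) * (cnj (u z) / N)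
            - u y / N * (\<Sum>t\<in>T. cnj (u t) * Q t z) + u y * cnj (u z) / N\<^sup>2 * N"
      by (simp only: sum.distrib sum_subtractf sum_distrib_left sum_distrib_right N_def)
    also have "\<dots> = R y z"
      using N by (simp add: idem yz Qu uQ R_def power2_eq_square)
    finally show "(\<Sum>t\<in>T. R y t * R t z) = R y z" .
  next
    have "(\<Sum>y\<in>T. R y y) = (\<Sum>y\<in>T. Q y y) - (\<Sum>y\<in>T. u y * cnj (u y)) / N"
      by (simp add: R_def sum_subtractf sum_divide_distrib)
    then have "(\<Sum>y\<in>T. R y y) = (\<Sum>y\<in>T. Q y y) - N / N"
      by (simp only: N_def)
    then show "(\<Sum>y\<in>T. R y y) = of_nat (card T) - of_nat (card (insert j J))"
      using N insert.hyps by (simp add: tr)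
  next
    fix y assume y: "y \<in> T"
    define k where "k = u y / N"
    define e where "e x = (\<Sum>t\<in>T. K j t * c t x)" for x
    define b where "b x = (if x = j then k else c y x - k * e x)" for x
    show "\<exists>c. \<forall>z\<in>T. (if y = z then 1 else 0) - R y z = (\<Sum>x\<in>insert j J. c x * K x z)"
    proof (intro exI[of _ b] ballI)
      fix z assume z: "z \<in> T"
      have "(if y = z then 1 else 0) - R y z = (if y = z then 1 else 0) - Q y z + k * cnj (u z)"
        by (simp add: R_def k_def)
      also have "\<dots> = (\<Sum>x\<in>J. c y x * K x z) + k * K j z
          - k * (\<Sum>x\<in>J. e x * K x z)"
        using c[OF y z] row[OF z, symmetric, folded e_def] by (simp add: right_diff_distrib)
      also have "\<dots> = k * K j z + (\<Sum>x\<in>J. (c y x - k * e x) * K x z)"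
        by (simp add: left_diff_distrib sum_subtractf sum_distrib_left mult.assoc)
      also have "(\<Sum>x\<in>J. (c y x - k * e x) * K x z) = (\<Sum>x\<in>J. b x * K x z)"
        using insert.hyps by (intro sum.cong) (auto simp: b_def)
      also have "k * K j z + \<dots> = (\<Sum>x\<in>insert j J. b x * K x z)"
        using insert.hyps by (simp add: b_def)
      finally show "(if y = z then 1 else 0) - R y z = (\<Sum>x\<in>insert j J. b x * K x z)" .
    qed
  next
    fix F y assume F: "\<forall>x\<in>insert j J. (\<Sum>y\<in>T. K x y * F y) = 0" and y: "y \<in> T"
    have QF: "(\<Sum>z\<in>T. Q y z * F z) = F y" if "y \<in> T" for y
      using fixed F that by simp
    have "(\<Sum>z\<in>T. cnj (u z) * F z) = (\<Sum>t\<in>T. K j t * (\<Sum>z\<in>T. Q t z * F z))"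
      unfolding cnj_u sum_distrib_left sum_distrib_right by (subst sum.swap) (simp add: mult.assoc)
    also have "\<dots> = (\<Sum>t\<in>T. K j t * F t)" by (simp add: QF)
    finally have uF: "(\<Sum>z\<in>T. cnj (u z) * F z) = 0" using F by simp
    have "(\<Sum>z\<in>T. R y z * F z) = (\<Sum>z\<in>T. Q y z * F z) - u y / N * (\<Sum>z\<in>T. cnj (u z) * F z)"
      by (simp add: R_def left_diff_distrib sum_subtractf sum_distrib_left mult.assoc)
    then show "(\<Sum>z\<in>T. R y z * F z) = F y" using QF[OF y] uF by simp
  qed
  then show ?case by blast
qed

text \<open>The weights \<open>\<rho>\<close> are the diagonal entries of the projection onto the solution space.  They add up
  to its dimension, and a solution at \<open>y\<close> is the inner product of itself with row \<open>y\<close> of the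
  projection, whose squared norm is \<open>\<rho> y\<close>.\<close>

lemma leverage_scores:
  fixes K :: "'x \<Rightarrow> 'y \<Rightarrow> complex"
  assumes "finite J" "finite T"
    and indep: "\<forall>g. (\<forall>y\<in>T. (\<Sum>x\<in>J. g x * K x y) = 0) \<longrightarrow> (\<forall>x\<in>J. g x = 0)"
  obtains \<rho> :: "'y \<Rightarrow> real" where "\<And>y. 0 \<le> \<rho> y"
    and "(\<Sum>y\<in>T. \<rho> y) = real (card T) - real (card J)"
    and "\<And>F y. (\<And>x. x \<in> J \<Longrightarrow> (\<Sum>y\<in>T. K x y * F y) = 0) \<Longrightarrow> y \<in> T \<Longrightarrow>
       (cmod (F y))\<^sup>2 \<le> \<rho> y * (\<Sum>z\<in>T. (cmod (F z))\<^sup>2)"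
proof -
  obtain Q where Q: "projects_onto_kernel K J T Q"
    using projection_onto_kernel_exists[OF assms] by blast
  note herm = projects_onto_kernelD(1)[OF Q] and idem = projects_onto_kernelD(2)[OF Q]
    and tr = projects_onto_kernelD(3)[OF Q] and fixed = projects_onto_kernelD(5)[OF Q]
  define \<rho> where "\<rho> y = (\<Sum>z\<in>T. (cmod (Q y z))\<^sup>2)" for y
  have diag: "of_real (\<rho> y) = Q y y" if "y \<in> T" for y
  proof -
    have "of_real (\<rho> y) = (\<Sum>z\<in>T. Q y z * Q z y)"
      unfolding \<rho>_def of_real_sum complex_norm_square by (rule sum.cong) (simp_all add: herm[of _ y])
    then show ?thesis using idem that by simp
  qed
  show thesis
  proof (rule that[of \<rho>])
    have "of_real (\<Sum>y\<in>T. \<rho> y) = (of_real (real (card T) - real (card J)) :: complex)"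
      using tr diag by simp
    then show "(\<Sum>y\<in>T. \<rho> y) = real (card T) - real (card J)"
      by (simp only: of_real_eq_iff)
  next
    fix F y assume "\<And>x. x \<in> J \<Longrightarrow> (\<Sum>y\<in>T. K x y * F y) = 0" "y \<in> T"
    then have "F y = (\<Sum>z\<in>T. Q y z * F z)" using fixed by simp
    then show "(cmod (F y))\<^sup>2 \<le> \<rho> y * (\<Sum>z\<in>T. (cmod (F z))\<^sup>2)"
      unfolding \<rho>_def by (metis cauchy_schwarz_complex)
  qed (simp add: \<rho>_def sum_nonneg)
qed

section \<open>Multi-graphs with one variable per edge\<close>

text \<open>The injection \<open>h\<close> only serves to number the edges and to orient them: an arc is positive if it
  has a smaller number than its reverse.\<close>

locale oriented_multigraph = fin_digraph G + bidirected_digraph G r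
  for G :: "('v, 'e) pre_digraph" and r :: "'e \<Rightarrow> 'e" +
  fixes h :: "'e \<Rightarrow> nat"
  assumes inj_h: "inj_on h (arcs G)"
begin

definition edge_index :: "'e \<Rightarrow> nat" where
  "edge_index a = min (h a) (h (r a))"

text \<open>The oriented edge as a vector in the free abelian group on the edges; it is also the exponent of
  the monomial that is attached to the arc.\<close>

definition arc_chain :: "'e \<Rightarrow> nat \<Rightarrow>\<^sub>0 int" where
  "arc_chain a = Poly_Mapping.single (edge_index a) (if h a < h (r a) then 1 else - 1)"

definition pos_arcs :: "'e set" where
  "pos_arcs = {a \<in> arcs G. h a < h (r a)}"

lemma h_arev_neq: "a \<in> arcs G \<Longrightarrow> h (r a) \<noteq> h a"
  using inj_h arev_neq arev_in_arcs by (meson inj_on_eq_iff)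

lemma edge_index_arev [simp]: "edge_index (r a) = edge_index a"
  by (simp add: edge_index_def min.commute)

lemma edge_index_eq:
  assumes "a \<in> arcs G" "b \<in> arcs G" "edge_index a = edge_index b"
  shows "a = b \<or> a = r b"
proof -
  have "h a = h b \<or> h a = h (r b) \<or> h (r a) = h b \<or> h (r a) = h (r b)"
    using assms(3) by (auto simp: edge_index_def min_def split: if_splits)
  then have "a = b \<or> a = r b \<or> r a = b \<or> r a = r b"
    using assms(1,2) inj_h arev_in_arcs by (auto dest: inj_onD)
  then show ?thesis using arev_arev by metis
qed

lemma arc_chain_arev: "a \<in> arcs G \<Longrightarrow> arc_chain (r a) = - arc_chain a"
  using h_arev_neq[of a] by (auto simp: arc_chain_def single_uminus)

lemma lookup_arc_chain:
  assumes "a \<in> arcs G" "b \<in> arcs G" "h b < h (r b)"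
  shows "Poly_Mapping.lookup (arc_chain a) (edge_index b)
    = (if a = b then 1 else if a = r b then - 1 else 0)"
proof (cases "edge_index a = edge_index b")
  case True
  then show ?thesis using assms edge_index_eq[OF assms(1,2)] arev_neq[of b]
    by (auto simp: arc_chain_def)
next
  case False
  then have "a \<noteq> b" "a \<noteq> r b" by auto
  with False show ?thesis by (simp add: arc_chain_def lookup_single)
qed

lemma sum_arcs_rev:
  assumes "\<And>a. a \<in> arcs G \<Longrightarrow> Q (r a) = Q' a"
  shows "(\<Sum>a | a \<in> arcs G \<and> Q a. f a) = (\<Sum>a | a \<in> arcs G \<and> Q' a. f (r a))"
proof -
  have "bij_betw r {a \<in> arcs G. Q' a} {a \<in> arcs G. Q a}"
    unfolding bij_betw_def
  proof (intro conjI subset_antisym subsetI)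
    show "x \<in> r ` {a \<in> arcs G. Q' a}" if "x \<in> {a \<in> arcs G. Q a}" for x
    proof
      show "x = r (r x)" by simp
      show "r x \<in> {a \<in> arcs G. Q' a}" using assms[of "r x"] that by simp
    qed
  qed (use assms in fastforce)+
  then show ?thesis by (rule sum.reindex_bij_betw[symmetric])
qed

end

section \<open>The generic operator of a regular multi-graph is nonsingular\<close>

locale weighted_multigraph = oriented_multigraph G r h
  for G :: "('v, 'e) pre_digraph" and r :: "'e \<Rightarrow> 'e" and h :: "'e \<Rightarrow> nat" +
  fixes w :: "'e \<Rightarrow> complex" and q :: "'v \<Rightarrow> real"
  assumes w_arev: "a \<in> arcs G \<Longrightarrow> w (r a) = cnj (w a)"
    and w_nonzero: "a \<in> arcs G \<Longrightarrow> w a \<noteq> 0"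
begin

definition arc_weight :: "'e \<Rightarrow> laurent" where
  "arc_weight a = Poly_Mapping.single (arc_chain a) (w a)"

text \<open>The Schroedinger operator with an independent variable on every edge.  Specialising the
  variables to complex numbers of modulus one gives the fibres of the operator on the abelian cover.\<close>

definition generic_op :: "('v \<Rightarrow> laurent) \<Rightarrow> 'v \<Rightarrow> laurent" where
  "generic_op f u = (\<Sum>a\<in>out_arcs G u. arc_weight a * f (head G a))
     + Poly_Mapping.single 0 (of_real (q u)) * f u"

lemma arc_weight_arev: "a \<in> arcs G \<Longrightarrow> arc_weight (r a) = laurent_star (arc_weight a)"
  by (simp add: arc_weight_def w_arev arc_chain_arev)

lemma arc_weight_nonzero: "a \<in> arcs G \<Longrightarrow> arc_weight a \<noteq> 0"
  using w_nonzero by (simp add: arc_weight_def single_eq_0_iff)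

lemma sum_out_arcs:
  fixes \<phi> :: "'e \<Rightarrow> 'x::comm_monoid_add"
  shows "(\<Sum>u\<in>verts G. \<Sum>a\<in>out_arcs G u. \<phi> a) = (\<Sum>a\<in>arcs G. \<phi> a)"
  unfolding out_arcs_def by (rule sum.group) auto

lemma generic_op_hermitian:
  "(\<Sum>u\<in>verts G. laurent_star (g u) * generic_op f u)
     = (\<Sum>u\<in>verts G. laurent_star (generic_op g u) * f u)"
proof -
  have "(\<Sum>u\<in>verts G. \<Sum>a\<in>out_arcs G u. laurent_star (g u) * (arc_weight a * f (head G a)))
      = (\<Sum>u\<in>verts G. \<Sum>a\<in>out_arcs G u. laurent_star (g (tail G a)) * (arc_weight a * f (head G a)))"
    by (intro sum.cong) auto
  also have "\<dots> = (\<Sum>a\<in>arcs G. laurent_star (g (tail G a)) * (arc_weight a * f (head G a)))"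
    by (rule sum_out_arcs)
  also have "\<dots> = (\<Sum>a\<in>arcs G. laurent_star (arc_weight a * g (head G a)) * f (tail G a))"
    using sum_arcs_rev[of "\<lambda>_. True" "\<lambda>_. True"
        "\<lambda>a. laurent_star (g (tail G a)) * (arc_weight a * f (head G a))"]
    by (simp add: arc_weight_arev mult_ac)
  also have "\<dots> = (\<Sum>u\<in>verts G. \<Sum>a\<in>out_arcs G u. laurent_star (arc_weight a * g (head G a)) * f (tail G a))"
    by (rule sum_out_arcs[symmetric])
  also have "\<dots> = (\<Sum>u\<in>verts G. \<Sum>a\<in>out_arcs G u. laurent_star (arc_weight a * g (head G a)) * f u)"
    by (intro sum.cong) auto
  finally show ?thesis
    by (simp add: generic_op_def distrib_left distrib_right sum.distrib sum_distrib_left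
        sum_distrib_right star_sum mult_ac)
qed

text \<open>The Leibniz rule: the commutator of the derivation with the operator is the current through the
  edge with index \<open>i\<close>.\<close>

lemma generic_op_deriv:
  "laurent_deriv i (generic_op f u) = generic_op (\<lambda>v. laurent_deriv i (f v)) u
     + (\<Sum>a\<in>out_arcs G u. of_int (Poly_Mapping.lookup (arc_chain a) i) * (arc_weight a * f (head G a)))"
proof -
  have "laurent_deriv i (arc_weight a)
      = of_int (Poly_Mapping.lookup (arc_chain a) i) * arc_weight a" for a
    by (simp add: arc_weight_def deriv_single')
  then show ?thesis
    by (simp add: generic_op_def deriv_mult deriv_sum deriv_single sum.distrib algebra_simps)
qed

text \<open>Only the two orientations of an edge see its variable.\<close>

lemma sum_arc_chain:
  fixes \<phi> :: "'e \<Rightarrow> 'x::ring_1"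
  assumes "I \<subseteq> arcs G" "e \<in> arcs G" "h e < h (r e)"
  shows "(\<Sum>a\<in>I. of_int (Poly_Mapping.lookup (arc_chain a) (edge_index e)) * \<phi> a)
    = (if e \<in> I then \<phi> e else 0) - (if r e \<in> I then \<phi> (r e) else 0)"
proof -
  have fin: "finite I" using finite_subset[OF assms(1) finite_arcs] .
  have "(\<Sum>a\<in>I. of_int (Poly_Mapping.lookup (arc_chain a) (edge_index e)) * \<phi> a)
    = (\<Sum>a\<in>I. (if a = e then \<phi> a else 0) - (if a = r e then \<phi> a else 0))"
    using assms arev_neq[of e] by (intro sum.cong refl) (auto simp: lookup_arc_chain)
  also have "\<dots> = (if e \<in> I then \<phi> e else 0) - (if r e \<in> I then \<phi> (r e) else 0)"
    using fin by (simp add: sum_subtractf sum.delta' cong: if_cong)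
  finally show ?thesis .
qed

lemma arc_cases_pos:
  assumes "a \<in> arcs G"
  obtains "h a < h (r a)" | "h (r a) < h (r (r a))"
  using h_arev_neq[OF assms] by fastforce

context
  fixes f :: "'v \<Rightarrow> laurent"
  assumes ker: "\<And>u. u \<in> verts G \<Longrightarrow> generic_op f u = 0"
begin

text \<open>Differentiate \<open>H f = 0\<close> in the variable of the edge and pair with \<open>f\<close>.  The term with the
  derivative of \<open>f\<close> vanishes because \<open>H\<close> is Hermitian, and what remains is the current through the
  edge.\<close>

lemma zero_current:
  assumes "a \<in> arcs G"
  shows "laurent_star (f (tail G a)) * arc_weight a * f (head G a)
    = laurent_star (f (head G a)) * arc_weight (r a) * f (tail G a)"
proof -
  have *: "laurent_star (f (tail G e)) * arc_weight e * f (head G e)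
    = laurent_star (f (head G e)) * arc_weight (r e) * f (tail G e)"
    if e: "e \<in> arcs G" "h e < h (r e)" for e
  proof -
    define i where "i = edge_index e"
    define \<phi> where "\<phi> a = laurent_star (f (tail G a)) * arc_weight a * f (head G a)" for a
    have "(\<Sum>a\<in>out_arcs G u. of_int (Poly_Mapping.lookup (arc_chain a) i) * \<phi> a)
        = - (laurent_star (f u) * generic_op (\<lambda>v. laurent_deriv i (f v)) u)"
      if "u \<in> verts G" for u
    proof -
      have "generic_op (\<lambda>v. laurent_deriv i (f v)) u
          = - (\<Sum>a\<in>out_arcs G u. of_int (Poly_Mapping.lookup (arc_chain a) i)
                * (arc_weight a * f (head G a)))"
        using generic_op_deriv[of i f u] ker[OF that] by (simp add: eq_neg_iff_add_eq_0)
      then show ?thesis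
        by (auto simp: sum_distrib_left \<phi>_def mult_ac intro!: sum.cong)
    qed
    then have "(\<Sum>a\<in>arcs G. of_int (Poly_Mapping.lookup (arc_chain a) i) * \<phi> a)
      = - (\<Sum>u\<in>verts G. laurent_star (f u) * generic_op (\<lambda>v. laurent_deriv i (f v)) u)"
      by (simp add: sum_negf flip: sum_out_arcs)
    also have "\<dots> = 0"
      by (simp add: generic_op_hermitian ker)
    finally have "\<phi> e - \<phi> (r e) = 0"
      using e by (simp add: i_def sum_arc_chain)
    then show ?thesis using e by (simp add: \<phi>_def)
  qed
  show ?thesis
    using arc_cases_pos[OF assms]
  proof cases
    case 1 then show ?thesis using * assms by blast
  next
    case 2 then show ?thesis using *[of "r a"] assms by simp
  qed
qed

definition supp :: "'v set" where "supp = {v \<in> verts G. f v \<noteq> 0}"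

definition inner_arcs :: "'e set" where
  "inner_arcs = {a \<in> arcs G. tail G a \<in> supp \<and> head G a \<in> supp}"

text \<open>On the torus this is \<open>-2\<close> times the derivative of the phase of \<open>f v\<close> with respect to the angle of
  the variable of \<open>e\<close>.\<close>

definition phase_deriv :: "'e \<Rightarrow> 'v \<Rightarrow> laurent fract" where
  "phase_deriv e v = log_deriv (edge_index e) (laurent_star (f v)) - log_deriv (edge_index e) (f v)"

lemma inner_arcs_arev [simp]: "a \<in> inner_arcs \<Longrightarrow> r a \<in> inner_arcs"
  by (auto simp: inner_arcs_def)

lemma finite_inner_arcs: "finite inner_arcs"
  by (simp add: inner_arcs_def)

lemma finite_supp: "finite supp"
  by (simp add: supp_def)

text \<open>The logarithmic derivative of \<open>zero_current\<close>.  The phase of \<open>f\<close> has to compensate the phase of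
  the arc weight, so along an inner arc it changes exactly with the variable of that arc.\<close>

lemma phase_deriv_diff:
  assumes "a \<in> inner_arcs"
  shows "phase_deriv e (head G a) - phase_deriv e (tail G a)
    = 2 * of_int (Poly_Mapping.lookup (arc_chain a) (edge_index e))"
proof -
  have a: "a \<in> arcs G" "f (tail G a) \<noteq> 0" "f (head G a) \<noteq> 0"
    using assms by (auto simp: inner_arcs_def supp_def)
  define L where "L = log_deriv (edge_index e)"
  define c where "c = Poly_Mapping.lookup (arc_chain a) (edge_index e)"
  have W: "L (arc_weight a) = of_int c" "L (arc_weight (r a)) = - of_int c"
    using a w_nonzero[of a] w_nonzero[of "r a"]
    by (auto simp: L_def c_def arc_weight_def log_deriv_single arc_chain_arev)
  have "L (laurent_star (f (tail G a)) * arc_weight a * f (head G a))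
     = L (laurent_star (f (head G a)) * arc_weight (r a) * f (tail G a))"
    using zero_current[OF a(1)] by simp
  then have "L (laurent_star (f (tail G a))) + of_int c + L (f (head G a))
     = L (laurent_star (f (head G a))) - of_int c + L (f (tail G a))"
    using a arc_weight_nonzero[of a] arc_weight_nonzero[of "r a"] unfolding W[symmetric]
    by (simp add: L_def log_deriv_mult W[unfolded L_def])
  then show ?thesis
    unfolding phase_deriv_def L_def[symmetric] c_def[symmetric] by (simp add: algebra_simps)
qed

text \<open>Summation by parts: a function on the vertices pairs to zero with a divergence-free function on
  the arcs.\<close>

lemma sum_phase_deriv:
  assumes "\<And>u. u \<in> supp \<Longrightarrow> (\<Sum>a | a \<in> inner_arcs \<and> tail G a = u. y a) = (0::laurent fract)"
  shows "(\<Sum>a\<in>inner_arcs. p (tail G a) * y a) = 0"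
proof -
  have "(\<Sum>a\<in>inner_arcs. p (tail G a) * y a)
      = (\<Sum>u\<in>supp. \<Sum>a | a \<in> inner_arcs \<and> tail G a = u. p (tail G a) * y a)"
    by (rule sum.group[symmetric]) (auto simp: finite_inner_arcs finite_supp inner_arcs_def)
  also have "\<dots> = (\<Sum>u\<in>supp. p u * (\<Sum>a | a \<in> inner_arcs \<and> tail G a = u. y a))"
    by (intro sum.cong refl) (auto simp: sum_distrib_left intro!: sum.cong)
  also have "\<dots> = 0" using assms by simp
  finally show ?thesis .
qed

text \<open>A cycle of inner edges would be such a flow.  The pairing of a flow with the potential
  \<open>phase_deriv e\<close> is zero since the flow has no divergence, and it is a multiple of the value of
  the flow at \<open>e\<close> since the potential changes along \<open>e\<close> only.\<close>

lemma flow_vanishes: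
  fixes y :: "'e \<Rightarrow> laurent fract"
  assumes anti: "\<And>a. a \<in> inner_arcs \<Longrightarrow> y (r a) = - y a"
    and cons: "\<And>u. u \<in> supp \<Longrightarrow> (\<Sum>a | a \<in> inner_arcs \<and> tail G a = u. y a) = 0"
    and a: "a \<in> inner_arcs"
  shows "y a = 0"
proof -
  have *: "y e = 0" if e: "e \<in> inner_arcs" "h e < h (r e)" for e
  proof -
    have e': "e \<in> arcs G" using e by (simp add: inner_arcs_def)
    have t: "(\<Sum>a\<in>inner_arcs. phase_deriv e (tail G a) * y a) = 0"
      using cons by (rule sum_phase_deriv)
    have "(\<Sum>a\<in>inner_arcs. phase_deriv e (head G a) * y a)
        = (\<Sum>a\<in>inner_arcs. phase_deriv e (tail G a) * y (r a))"
      by (rule sum.reindex_bij_witness[of _ r r]) (auto, auto simp: inner_arcs_def)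
    also have "\<dots> = 0"
      using t by (simp add: anti sum_negf)
    finally have "0 = (\<Sum>a\<in>inner_arcs. (phase_deriv e (head G a) - phase_deriv e (tail G a)) * y a)"
      using t by (simp add: left_diff_distrib sum_subtractf)
    also have "\<dots> = (\<Sum>a\<in>inner_arcs. of_int (Poly_Mapping.lookup (arc_chain a) (edge_index e)) * (2 * y a))"
    proof (rule sum.cong)
      fix a assume "a \<in> inner_arcs"
      then show "(phase_deriv e (head G a) - phase_deriv e (tail G a)) * y a =
          of_int (Poly_Mapping.lookup (arc_chain a) (edge_index e)) * (2 * y a)"
        using phase_deriv_diff[of a] by (simp add: mult_ac)
    qed simp
    also have "\<dots> = 2 * y e - 2 * y (r e)"
      using e e' by (subst sum_arc_chain) (auto simp: inner_arcs_def)
    also have "\<dots> = 4 * y e" using anti[OF e(1)] by simp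
    finally have "4 * y e = 0" by simp
    moreover have "(4 :: laurent fract) \<noteq> 0"
      using to_fract_of_int[of 4, where 'a=laurent] by (metis of_int_numeral to_fract_eq_0_iff zero_neq_numeral)
    ultimately show "y e = 0" by simp
  qed
  have "a \<in> arcs G" using a by (simp add: inner_arcs_def)
  then show ?thesis
  proof (cases rule: arc_cases_pos)
    case 1 then show ?thesis using * a by blast
  next
    case 2 then show ?thesis using *[of "r a"] anti[of a] a by simp
  qed
qed

lemma generic_op_inner:
  assumes "\<And>v. v \<in> verts G \<Longrightarrow> v \<notin> supp \<Longrightarrow> g v = 0" "u \<in> supp"
  shows "generic_op g u = (\<Sum>a | a \<in> inner_arcs \<and> tail G a = u. arc_weight a * g (head G a))
     + Poly_Mapping.single 0 (of_real (q u)) * g u"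
proof -
  have "(\<Sum>a\<in>out_arcs G u. arc_weight a * g (head G a))
      = (\<Sum>a | a \<in> inner_arcs \<and> tail G a = u. arc_weight a * g (head G a))"
  proof (rule sum.mono_neutral_right)
    show "\<forall>a\<in>out_arcs G u - {a. a \<in> inner_arcs \<and> tail G a = u}. arc_weight a * g (head G a) = 0"
    proof
      fix a assume "a \<in> out_arcs G u - {a. a \<in> inner_arcs \<and> tail G a = u}"
      then have "head G a \<in> verts G" "head G a \<notin> supp"
        using assms(2) by (auto simp: inner_arcs_def)
      then show "arc_weight a * g (head G a) = 0" using assms(1) by simp
    qed
  qed (auto simp: inner_arcs_def)
  then show ?thesis by (simp add: generic_op_def)
qed

text \<open>After conjugation by \<open>f\<close> the operator on the support becomes a weighted graph Laplacian, whose
  edge weights \<open>J\<close> are symmetric by \<open>zero_current\<close>.  If \<open>g\<close> is in its kernel, then \<open>J\<close> times the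
  gradient of \<open>g / f\<close> is a flow, hence zero.\<close>

lemma local_kernel_proportional:
  assumes supp_g: "\<And>v. v \<in> verts G \<Longrightarrow> v \<notin> supp \<Longrightarrow> g v = 0"
    and ker_g: "\<And>u. u \<in> supp \<Longrightarrow> generic_op g u = 0"
    and a: "a \<in> inner_arcs"
  shows "to_fract (g (head G a)) / to_fract (f (head G a))
       = to_fract (g (tail G a)) / to_fract (f (tail G a))"
proof -
  define p where "p v = to_fract (g v) / to_fract (f v)" for v
  define J where "J a = to_fract (laurent_star (f (tail G a)) * arc_weight a * f (head G a))" for a
  define y where "y a = J a * (p (head G a) - p (tail G a))" for a
  have "y a = 0"
  proof (rule flow_vanishes)
    fix a assume a: "a \<in> inner_arcs"
    then have "a \<in> arcs G" by (simp add: inner_arcs_def)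
    then have "J (r a) = J a" using zero_current[of a] by (simp add: J_def)
    then show "y (r a) = - y a" using \<open>a \<in> arcs G\<close> by (simp add: y_def algebra_simps)
  next
    fix u assume u: "u \<in> supp"
    have f0: "\<And>v. v \<in> verts G \<Longrightarrow> v \<notin> supp \<Longrightarrow> f v = 0" by (simp add: supp_def)
    define A where "A = {a. a \<in> inner_arcs \<and> tail G a = u}"
    define c :: "laurent fract" where "c = to_fract (Poly_Mapping.single 0 (of_real (q u)))"
    have fu: "f u \<noteq> 0" using u by (simp add: supp_def)
    have eqg: "(\<Sum>a\<in>A. to_fract (arc_weight a) * to_fract (g (head G a))) = - c * to_fract (g u)"
    proof -
      have "to_fract (generic_op g u) = 0" using ker_g[OF u] by simp
      then show ?thesis
        by (subst (asm) generic_op_inner)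
          (use supp_g u in \<open>auto simp: to_fract_sum A_def c_def eq_neg_iff_add_eq_0\<close>)
    qed
    have eqf: "(\<Sum>a\<in>A. to_fract (arc_weight a) * to_fract (f (head G a))) = - c * to_fract (f u)"
    proof -
      have "to_fract (generic_op f u) = 0" using ker u by (simp add: supp_def)
      then show ?thesis
        by (subst (asm) generic_op_inner)
          (use f0 u in \<open>auto simp: to_fract_sum A_def c_def eq_neg_iff_add_eq_0\<close>)
    qed
    have "(\<Sum>a\<in>A. y a) = (\<Sum>a\<in>A. to_fract (laurent_star (f u)) * (to_fract (arc_weight a) * to_fract (g (head G a)))
        - to_fract (laurent_star (f u)) * p u * (to_fract (arc_weight a) * to_fract (f (head G a))))"
    proof (rule sum.cong)
      fix a assume "a \<in> A"
      then have "f (head G a) \<noteq> 0" "tail G a = u" by (auto simp: A_def inner_arcs_def supp_def)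
      then show "y a = to_fract (laurent_star (f u)) * (to_fract (arc_weight a) * to_fract (g (head G a)))
        - to_fract (laurent_star (f u)) * p u * (to_fract (arc_weight a) * to_fract (f (head G a)))"
        by (simp add: y_def J_def p_def algebra_simps)
    qed simp
    also have "\<dots> = to_fract (laurent_star (f u)) * (- c * to_fract (g u))
        - to_fract (laurent_star (f u)) * p u * (- c * to_fract (f u))"
      by (simp only: sum_subtractf sum_distrib_left[symmetric] eqg eqf)
    also have "\<dots> = 0" using fu by (simp add: p_def)
    finally show "(\<Sum>a | a \<in> inner_arcs \<and> tail G a = u. y a) = 0" by (simp add: A_def)
  qed (rule a)
  moreover have "J a \<noteq> 0"
    using a arc_weight_nonzero[of a] by (auto simp: J_def inner_arcs_def supp_def)
  ultimately show ?thesis by (simp add: y_def p_def)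
qed

definition boundary :: "'v set" where
  "boundary = {b \<in> verts G - supp. \<exists>a\<in>arcs G. tail G a = b \<and> head G a \<in> supp}"

text \<open>Among the equations at vertices of the support and its boundary, only that at \<open>tail G e\<close>
  contains the variable of \<open>e\<close> with a nonzero factor from \<open>f\<close>.\<close>

lemma generic_op_boundary_deriv:
  assumes e: "e \<in> arcs G" "tail G e \<in> boundary" "head G e \<in> supp"
    and u: "u \<in> supp \<union> boundary"
  shows "generic_op (\<lambda>v. laurent_deriv (edge_index e) (f v)) u = 0 \<longleftrightarrow> u \<noteq> tail G e"
proof -
  have tail_e: "tail G e \<notin> supp" "f (tail G e) = 0" using e(2) by (auto simp: boundary_def supp_def)
  have u_verts: "u \<in> verts G" using u by (auto simp: supp_def boundary_def)
  define i where "i = edge_index e"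
  define \<phi> where "\<phi> a = arc_weight a * f (head G a)" for a
  have "generic_op (\<lambda>v. laurent_deriv i (f v)) u
      = - (\<Sum>a\<in>out_arcs G u. of_int (Poly_Mapping.lookup (arc_chain a) i) * \<phi> a)"
    using generic_op_deriv[of i f u] ker[OF u_verts] by (simp add: eq_neg_iff_add_eq_0 \<phi>_def)
  moreover have "(\<Sum>a\<in>out_arcs G u. of_int (Poly_Mapping.lookup (arc_chain a) i) * \<phi> a) = 0
      \<longleftrightarrow> u \<noteq> tail G e"
  proof -
    have ne: "\<phi> e \<noteq> 0" using e arc_weight_nonzero[of e] by (simp add: \<phi>_def supp_def)
    have z: "\<phi> (r e) = 0" using e tail_e by (simp add: \<phi>_def)
    have sub: "out_arcs G u \<subseteq> arcs G" by auto
    from e(1) show ?thesis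
    proof (cases rule: arc_cases_pos)
      case 1
      then show ?thesis using e ne z sum_arc_chain[OF sub, of e \<phi>] by (auto simp: i_def)
    next
      case 2
      then show ?thesis using e ne z sum_arc_chain[OF sub, of "r e" \<phi>]
        by (auto simp: i_def)
    qed
  qed
  ultimately show ?thesis by (simp add: i_def)
qed

lemma generic_op_scaled_sum:
  "to_fract (generic_op g u) = (\<Sum>a\<in>out_arcs G u. to_fract (arc_weight a) * to_fract (g (head G a)))
     + to_fract (Poly_Mapping.single 0 (of_real (q u))) * to_fract (g u)"
  by (simp add: generic_op_def to_fract_sum)

text \<open>A dimension count.  The constant function, the functions \<open>\<partial>f / f\<close> for the chosen edges at the
  boundary and the functions \<open>phase_deriv e\<close> are linearly independent on the support: differences
  along inner edges detect the third kind alone, and after that the equations at the boundary detect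
  the second kind.\<close>

lemma card_inner_edges_boundary:
  assumes "supp \<noteq> {}"
  shows "1 + card boundary + card (inner_arcs \<inter> pos_arcs) \<le> card supp"
proof (rule ccontr)
  assume neg: "\<not> ?thesis"
  define B where "B = boundary"
  define E where "E = inner_arcs \<inter> pos_arcs"
  have finB: "finite B" by (simp add: B_def boundary_def)
  have finE: "finite E" by (simp add: E_def finite_inner_arcs)
  have "\<exists>e. e \<in> arcs G \<and> tail G e = b \<and> head G e \<in> supp" if "b \<in> B" for b
    using that by (auto simp: B_def boundary_def)
  then obtain t where t: "\<And>b. b \<in> B \<Longrightarrow> t b \<in> arcs G \<and> tail G (t b) = b \<and> head G (t b) \<in> supp"
    by metis
  define D where "D b v = laurent_deriv (edge_index (t b)) (f v)" for b v
  define p where "p b v = to_fract (D b v) / to_fract (f v)" for b v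
  \<comment> \<open>\<open>None\<close> indexes the vector \<open>f\<close> itself; all vectors are divided by \<open>f\<close>\<close>
  define I where "I = insert None (Some ` (B <+> E))"
  define M where "M i = (case i of None \<Rightarrow> (\<lambda>_. 1) | Some (Inl b) \<Rightarrow> p b | Some (Inr e) \<Rightarrow> phase_deriv e)"
    for i :: "('v + 'e) option"
  have sum_I: "(\<Sum>i\<in>I. c i * M i v)
      = c None + (\<Sum>b\<in>B. c (Some (Inl b)) * p b v) + (\<Sum>e\<in>E. c (Some (Inr e)) * phase_deriv e v)" for c v
  proof -
    have "(\<Sum>i\<in>I. c i * M i v) = c None + (\<Sum>x\<in>B <+> E. c (Some x) * M (Some x) v)"
      unfolding I_def using finB finE
      by (subst sum.insert) (auto simp: M_def sum.reindex)
    then show ?thesis using finB finE by (simp add: sum.Plus M_def)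
  qed
  have "card I = 1 + card B + card E"
    using finB finE by (simp add: I_def card_image card_Plus)
  then have "card supp < card I" using neg by (simp add: B_def E_def)
  moreover have "finite I" using finB finE by (simp add: I_def)
  ultimately obtain c where c: "\<exists>i\<in>I. c i \<noteq> 0"
    and rel: "\<forall>v\<in>supp. (\<Sum>i\<in>I. c i * M i v) = 0"
    using nontrivial_linear_relation[OF finite_supp, of I M] by auto
  have D_supp: "D b v = 0" if "v \<in> verts G" "v \<notin> supp" for b v
    using that by (simp add: D_def supp_def)
  have D_ker: "generic_op (D b) u = 0 \<longleftrightarrow> u \<noteq> b" if "b \<in> B" "u \<in> supp \<union> B" for b u
    using generic_op_boundary_deriv[of "t b" u] t[OF that(1)] that unfolding D_def B_def by simp
  have B_supp: "b \<notin> supp" if "b \<in> B" for b using that by (simp add: B_def boundary_def)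
  have p_const: "p b (head G a) = p b (tail G a)" if "b \<in> B" "a \<in> inner_arcs" for a b
    unfolding p_def using that D_supp D_ker B_supp
    by (intro local_kernel_proportional) auto
  have cE: "c (Some (Inr e)) = 0" if e: "e \<in> E" for e
  proof -
    have e': "e \<in> inner_arcs" "e \<in> arcs G" "h e < h (r e)"
      using e by (auto simp: E_def pos_arcs_def)
    then have "tail G e \<in> supp" "head G e \<in> supp" by (auto simp: inner_arcs_def)
    then have "0 = (\<Sum>i\<in>I. c i * M i (head G e)) - (\<Sum>i\<in>I. c i * M i (tail G e))"
      using rel by simp
    also have "\<dots> = (\<Sum>e'\<in>E. c (Some (Inr e')) * (phase_deriv e' (head G e) - phase_deriv e' (tail G e)))"
      using e'(1) by (simp add: sum_I p_const right_diff_distrib sum_subtractf)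
    also have "\<dots> = (\<Sum>e'\<in>E. if e' = e then c (Some (Inr e)) * 2 else 0)"
    proof (rule sum.cong)
      fix e1 assume e1: "e1 \<in> E"
      then have "e1 \<in> arcs G" "h e1 < h (r e1)" by (auto simp: E_def pos_arcs_def)
      then show "c (Some (Inr e1)) * (phase_deriv e1 (head G e) - phase_deriv e1 (tail G e))
          = (if e1 = e then c (Some (Inr e)) * 2 else 0)"
        using e' by (auto simp: phase_deriv_diff lookup_arc_chain)
    qed simp
    also have "\<dots> = c (Some (Inr e)) * 2" using finE e by simp
    finally have "c (Some (Inr e)) * 2 = 0" by simp
    moreover have "(2 :: laurent fract) \<noteq> 0"
      using to_fract_of_int[of 2, where 'a=laurent] by (metis of_int_numeral to_fract_eq_0_iff zero_neq_numeral)
    ultimately show ?thesis by simp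
  qed
  have rel': "c None * to_fract (f v) + (\<Sum>b\<in>B. c (Some (Inl b)) * to_fract (D b v)) = 0"
    if "v \<in> verts G" for v
  proof (cases "v \<in> supp")
    case True
    then have "(c None + (\<Sum>b\<in>B. c (Some (Inl b)) * p b v)) * to_fract (f v) = 0"
      using rel cE by (simp add: sum_I)
    moreover have "f v \<noteq> 0" using True by (simp add: supp_def)
    ultimately show ?thesis
      by (simp add: distrib_right sum_distrib_right p_def)
  next
    case False
    then show ?thesis using that D_supp by (simp add: supp_def)
  qed
  have cB: "c (Some (Inl b)) = 0" if b: "b \<in> B" for b
  proof -
    have bv: "b \<in> verts G" using b by (simp add: B_def boundary_def)
    define K where "K g = (\<Sum>a\<in>out_arcs G b. to_fract (arc_weight a) * g (head G a))
     + to_fract (Poly_Mapping.single 0 (of_real (q b))) * g b" for g :: "'v \<Rightarrow> laurent fract"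
    have K: "K (\<lambda>v. to_fract (g v)) = to_fract (generic_op g b)" for g
      by (simp add: K_def generic_op_scaled_sum)
    have "0 = K (\<lambda>v. c None * to_fract (f v) + (\<Sum>b\<in>B. c (Some (Inl b)) * to_fract (D b v)))"
      using rel' bv by (simp add: K_def head_in_verts)
    also have "\<dots> = c None * K (\<lambda>v. to_fract (f v)) + (\<Sum>b\<in>B. c (Some (Inl b)) * K (\<lambda>v. to_fract (D b v)))"
    proof -
      have K_add: "K (\<lambda>v. x v + y v) = K x + K y" for x y
        by (simp add: K_def distrib_left sum.distrib)
      have K_scale: "K (\<lambda>v. k * x v) = k * K x" for k x
        by (simp add: K_def distrib_left sum_distrib_left mult_ac)
      have K_sum: "K (\<lambda>v. \<Sum>b\<in>B'. x b v) = (\<Sum>b\<in>B'. K (x b))" if "finite B'" for B' :: "'v set" and x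
        using that by induction (simp_all add: K_add, simp add: K_def)
      show ?thesis by (simp only: K_add K_sum[OF finB] K_scale)
    qed
    also have "\<dots> = (\<Sum>b'\<in>B. if b' = b then c (Some (Inl b)) * to_fract (generic_op (D b) b) else 0)"
      using D_ker b by (auto simp: K ker[OF bv] intro!: sum.cong)
    also have "\<dots> = c (Some (Inl b)) * to_fract (generic_op (D b) b)"
      using finB b by simp
    finally show ?thesis using D_ker[OF b, of b] b by simp
  qed
  obtain v where v: "v \<in> supp" using assms by auto
  then have "c None = 0" using rel'[of v] cB by (simp add: supp_def)
  then show False using c cB cE by (auto simp: I_def)
qed

text \<open>Of the arcs that start in the support, those that stay inside number twice the inner edges; the
  reverses of the others start in the boundary.\<close>

lemma regular_imp_supp_empty:
  assumes deg: "\<And>v. v \<in> verts G \<Longrightarrow> out_degree G v = d" and d: "2 \<le> d"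
  shows "supp = {}"
proof (rule ccontr)
  assume ne: "supp \<noteq> {}"
  define E where "E = inner_arcs \<inter> pos_arcs"
  define out where "out = {a \<in> arcs G. tail G a \<in> supp \<and> head G a \<notin> supp}"
  have card_tail: "card {a \<in> arcs G. tail G a \<in> Y} = d * card Y" if "Y \<subseteq> verts G" for Y
  proof -
    have "{a \<in> arcs G. tail G a \<in> Y} = (\<Union>u\<in>Y. out_arcs G u)" by auto
    then have "card {a \<in> arcs G. tail G a \<in> Y} = (\<Sum>u\<in>Y. card (out_arcs G u))"
      using finite_subset[OF that] by (simp only:) (rule card_UN_disjoint, auto)
    also have "\<dots> = (\<Sum>u\<in>Y. d)"
      using that deg by (intro sum.cong refl) (auto simp: out_degree_def)
    finally show ?thesis by (simp add: mult.commute)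
  qed
  have "inner_arcs = E \<union> r ` E"
  proof (intro equalityI subsetI)
    fix a assume a: "a \<in> inner_arcs"
    then have "a \<in> arcs G" by (simp add: inner_arcs_def)
    then show "a \<in> E \<union> r ` E"
    proof (cases rule: arc_cases_pos)
      case 1 then show ?thesis using a by (auto simp: E_def pos_arcs_def inner_arcs_def)
    next
      case 2
      then have "r a \<in> E" using a by (auto simp: E_def pos_arcs_def inner_arcs_def)
      then have "r (r a) \<in> r ` E" by blast
      then show ?thesis by simp
    qed
  qed (auto simp: E_def)
  then have "card inner_arcs \<le> card E + card (r ` E)" by (metis card_Un_le)
  also have "\<dots> \<le> 2 * card E" using card_image_le[of E r] finite_inner_arcs by (simp add: E_def)
  finally have inner: "card inner_arcs \<le> 2 * card E" .
  have "r ` out \<subseteq> {a \<in> arcs G. tail G a \<in> boundary}"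
  proof
    fix x assume "x \<in> r ` out"
    then obtain a where a: "a \<in> out" "x = r a" by auto
    then have "head G a \<in> boundary"
      by (auto simp: out_def boundary_def intro!: bexI[of _ "r a"])
    then show "x \<in> {a \<in> arcs G. tail G a \<in> boundary}" using a by (auto simp: out_def)
  qed
  then have "card (r ` out) \<le> card {a \<in> arcs G. tail G a \<in> boundary}"
    by (intro card_mono) auto
  then have "card out \<le> d * card boundary"
    using card_tail[of boundary] by (simp add: card_image inj_on_arev boundary_def)
  moreover have "d * card supp = card (inner_arcs \<union> out)"
  proof -
    have "{a \<in> arcs G. tail G a \<in> supp} = inner_arcs \<union> out"
      by (auto simp: inner_arcs_def out_def)
    then show ?thesis using card_tail[of supp] by (simp add: supp_def)
  qed
  moreover have "card (inner_arcs \<union> out) \<le> card inner_arcs + card out" by (rule card_Un_le)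
  ultimately have "d * card supp \<le> 2 * card E + d * card boundary" using inner by linarith
  moreover have "d * (1 + card boundary + card E) \<le> d * card supp"
    unfolding E_def by (rule mult_le_mono2[OF card_inner_edges_boundary[OF ne]])
  moreover have "2 * card E \<le> d * card E" using d by simp
  ultimately show False using d by (simp add: distrib_left)
qed

end

text \<open>A real eigenvalue is absorbed into the potential.  A non-real one contradicts Hermitian symmetry
  and definiteness of the pairing.\<close>

lemma generic_op_no_eigenvector:
  assumes deg: "\<And>v. v \<in> verts G \<Longrightarrow> out_degree G v = d" and d: "2 \<le> d"
    and eig: "\<And>u. u \<in> verts G \<Longrightarrow> generic_op f u = Poly_Mapping.single 0 l * f u"
    and v: "v \<in> verts G"
  shows "f v = 0"
proof (cases "l = cnj l")
  case True
  interpret shifted: weighted_multigraph G r h w "\<lambda>v. q v - Re l"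
    by unfold_locales (simp_all add: w_arev w_nonzero)
  have l: "of_real (Re l) = l" using True by (simp add: complex_eq_iff)
  have "shifted.generic_op f u = generic_op f u - Poly_Mapping.single 0 l * f u" for u
    by (simp add: shifted.generic_op_def generic_op_def shifted.arc_weight_def arc_weight_def l
        single_diff left_diff_distrib)
  then have ker: "shifted.generic_op f u = 0" if "u \<in> verts G" for u
    using eig that by simp
  then have "shifted.supp f = {}"
    using deg d by (intro shifted.regular_imp_supp_empty) auto
  then show ?thesis using v shifted.supp_def[OF ker] by auto
next
  case False
  define S where "S = (\<Sum>u\<in>verts G. laurent_star (f u) * f u)"
  have "Poly_Mapping.single 0 l * S = Poly_Mapping.single 0 (cnj l) * S"
    using generic_op_hermitian[of f f] eig by (simp add: S_def sum_distrib_left mult_ac)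
  then have "Poly_Mapping.single 0 (l - cnj l) * S = 0"
    by (simp add: single_diff left_diff_distrib)
  then have "(\<Sum>u\<in>verts G. laurent_star (f u) * f u) = 0"
    using False by (simp add: single_eq_0_iff S_def)
  then show ?thesis by (rule sum_star_mult_eq_0[OF finite_verts _ v])
qed

lemma lookup_single_mult:
  fixes f :: laurent
  shows "Poly_Mapping.lookup (Poly_Mapping.single m c * f) k = c * Poly_Mapping.lookup f (k - m)"
  by (induction f rule: laurent_induct)
    (auto simp: mult_single lookup_single when_def lookup_add distrib_left)

text \<open>A finitely supported function on pairs of a vertex and a chain is a vector of Laurent polynomials;
  the sign in \<open>g v (- m)\<close> turns the shift by \<open>arc_chain a\<close> into multiplication by the monomial of
  \<open>a\<close>.\<close>

lemma finitely_supported_no_eigenfunction: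
  fixes g :: "'v \<Rightarrow> (nat \<Rightarrow>\<^sub>0 int) \<Rightarrow> complex"
  assumes deg: "\<And>v. v \<in> verts G \<Longrightarrow> out_degree G v = d" and d: "2 \<le> d"
    and fin: "\<And>v. v \<in> verts G \<Longrightarrow> finite {c. g v c \<noteq> 0}"
    and eig: "\<And>u c. u \<in> verts G \<Longrightarrow>
      (\<Sum>a\<in>out_arcs G u. w a * g (head G a) (c + arc_chain a)) + q u * g u c = l * g u c"
    and v: "v \<in> verts G"
  shows "g v c = 0"
proof -
  define f where "f v = Abs_poly_mapping (\<lambda>m. g v (- m))" for v
  have lookup_f: "Poly_Mapping.lookup (f v) m = g v (- m)" if "v \<in> verts G" for v m
  proof -
    have "{m. g v (- m) \<noteq> 0} = uminus ` {c. g v c \<noteq> 0}"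
      by (auto intro: image_eqI[where x="- m" for m])
    then show ?thesis using fin[OF that] by (simp add: f_def lookup_Abs_poly_mapping)
  qed
  have "f v = 0"
  proof (rule generic_op_no_eigenvector[OF deg d _ v])
    fix u assume u: "u \<in> verts G"
    show "generic_op f u = Poly_Mapping.single 0 l * f u"
    proof (rule poly_mapping_eqI)
      fix k
      have "Poly_Mapping.lookup (generic_op f u) k
        = (\<Sum>a\<in>out_arcs G u. w a * g (head G a) (- k + arc_chain a)) + q u * g u (- k)"
        using u by (simp add: generic_op_def lookup_add lookup_sum arc_weight_def lookup_single_mult
            lookup_f head_in_verts)
      then show "Poly_Mapping.lookup (generic_op f u) k = Poly_Mapping.lookup (Poly_Mapping.single 0 l * f u) k"
        using eig[OF u, of "- k"] u by (simp add: lookup_single_mult lookup_f)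
    qed
  qed
  then show ?thesis using lookup_f[OF v, of "- c"] by simp
qed

end

section \<open>Square-summable eigenfunctions over the lattice of chains\<close>

text \<open>Boxes form a Foelner sequence of the group \<open>\<int>\<^sup>m\<close>.\<close>

definition chain_box :: "nat \<Rightarrow> int \<Rightarrow> int \<Rightarrow> (nat \<Rightarrow>\<^sub>0 int) set" where
  "chain_box m lo hi = {c. Poly_Mapping.keys c \<subseteq> {..<m} \<and>
     (\<forall>i<m. lo \<le> Poly_Mapping.lookup c i \<and> Poly_Mapping.lookup c i < hi)}"

lemma chain_box_card: "finite (chain_box m lo hi) \<and> card (chain_box m lo hi) = nat (hi - lo) ^ m"
proof -
  define \<phi> where "\<phi> c = restrict (Poly_Mapping.lookup c) {..<m}" for c :: "nat \<Rightarrow>\<^sub>0 int"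
  define \<psi> where "\<psi> g = Abs_poly_mapping (\<lambda>i. if i < m then g i else 0)" for g :: "nat \<Rightarrow> int"
  have lookup_\<psi>: "Poly_Mapping.lookup (\<psi> g) = (\<lambda>i. if i < m then g i else 0)" for g
    unfolding \<psi>_def by (rule lookup_Abs_poly_mapping) (rule finite_subset[of _ "{..<m}"], auto)
  have "bij_betw \<phi> (chain_box m lo hi) ({..<m} \<rightarrow>\<^sub>E {lo..<hi})"
  proof (rule bij_betw_byWitness[where f'=\<psi>])
    show "\<forall>c\<in>chain_box m lo hi. \<psi> (\<phi> c) = c"
      by (auto simp: chain_box_def lookup_\<psi> \<phi>_def in_keys_iff intro!: poly_mapping_eqI)
    show "\<forall>g\<in>{..<m} \<rightarrow>\<^sub>E {lo..<hi}. \<phi> (\<psi> g) = g"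
      by (auto simp: lookup_\<psi> \<phi>_def fun_eq_iff PiE_def extensional_def restrict_def)
    show "\<phi> ` chain_box m lo hi \<subseteq> {..<m} \<rightarrow>\<^sub>E {lo..<hi}"
      by (auto simp: \<phi>_def chain_box_def PiE_def extensional_def)
    show "\<psi> ` ({..<m} \<rightarrow>\<^sub>E {lo..<hi}) \<subseteq> chain_box m lo hi"
      by (auto simp: chain_box_def lookup_\<psi> in_keys_iff PiE_def Pi_def split: if_splits)
  qed
  then show ?thesis
    using bij_betw_finite[of \<phi>] bij_betw_same_card[of \<phi>] finite_PiE[of "{..<m}" "\<lambda>_. {lo..<hi}"]
    by (auto simp: card_PiE)
qed

context weighted_multigraph
begin

lemma chain_box_add_arc:
  assumes "c \<in> chain_box m 1 (n - 1)" "edge_index a < m"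
  shows "c + arc_chain a \<in> chain_box m 0 n"
proof -
  have "Poly_Mapping.keys (c + arc_chain a) \<subseteq> Poly_Mapping.keys c \<union> Poly_Mapping.keys (arc_chain a)"
    by (rule Poly_Mapping.keys_add)
  then have "Poly_Mapping.keys (c + arc_chain a) \<subseteq> {..<m}"
    using assms by (auto simp: chain_box_def arc_chain_def split: if_splits)
  moreover have "0 \<le> Poly_Mapping.lookup (c + arc_chain a) i
      \<and> Poly_Mapping.lookup (c + arc_chain a) i < n" if "i < m" for i
  proof -
    have "1 \<le> Poly_Mapping.lookup c i \<and> Poly_Mapping.lookup c i < n - 1"
      using assms that by (simp add: chain_box_def)
    then show ?thesis by (auto simp: lookup_add arc_chain_def lookup_single when_def)
  qed
  ultimately show ?thesis by (simp add: chain_box_def)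
qed

text \<open>The equations at interior points of the box are independent, so \<open>leverage_scores\<close> applies with
  a total weight equal to the number of boundary points of the box times the number of vertices.
  Every translate of \<open>F\<close> along the lattice solves the same equations, so the weight at each point
  \<open>(v, c)\<close> of the box bounds the same value \<open>F v c0\<close>.\<close>

lemma box_estimate:
  fixes F :: "'v \<Rightarrow> (nat \<Rightarrow>\<^sub>0 int) \<Rightarrow> complex"
  assumes deg: "\<And>v. v \<in> verts G \<Longrightarrow> out_degree G v = d" and d: "2 \<le> d"
    and bound: "\<And>A. finite A \<Longrightarrow> A \<subseteq> verts G \<times> UNIV \<Longrightarrow> (\<Sum>y\<in>A. (cmod (F (fst y) (snd y)))\<^sup>2) \<le> M"
    and eig: "\<And>u c. u \<in> verts G \<Longrightarrow>
      (\<Sum>a\<in>out_arcs G u. w a * F (head G a) (c + arc_chain a)) + q u * F u c = l * F u c"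
    and v: "v \<in> verts G" and m: "\<And>a. a \<in> arcs G \<Longrightarrow> edge_index a < m" and N: "2 \<le> N"
  shows "real N ^ m * (cmod (F v c0))\<^sup>2 \<le> M * (card (verts G) * (real N ^ m - real (N - 2) ^ m))"
proof -
  define B where "B = chain_box m 0 (int N)"
  define B' where "B' = chain_box m 1 (int N - 1)"
  define T where "T = verts G \<times> B"
  define J where "J = verts G \<times> B'"
  have fin: "finite B" "finite B'" "finite T" "finite J"
    by (simp_all add: B_def B'_def T_def J_def chain_box_card)
  have card_B: "card B = N ^ m" "card B' = (N - 2) ^ m"
    using N by (auto simp: B_def B'_def chain_box_card nat_diff_distrib' intro!: arg_cong[where f="\<lambda>x. x ^ m"])
  have B'_B: "c \<in> B" if "c \<in> B'" for c
    using that by (auto simp: B_def B'_def chain_box_def)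
  have step: "c + arc_chain a \<in> B" if "c \<in> B'" "a \<in> arcs G" for c a
    using that m unfolding B_def B'_def by (intro chain_box_add_arc) auto
  define K where "K x y = (\<Sum>a\<in>out_arcs G (fst x). if y = (head G a, snd x + arc_chain a) then w a else 0)
      + (if y = x then of_real (q (fst x)) - l else 0)" for x y :: "'v \<times> (nat \<Rightarrow>\<^sub>0 int)"
  have K_apply: "(\<Sum>y\<in>T. K x y * H y) = (\<Sum>a\<in>out_arcs G (fst x). w a * H (head G a, snd x + arc_chain a))
      + (of_real (q (fst x)) - l) * H x" if "x \<in> J" for x H
  proof -
    have x: "x \<in> T" "\<And>a. a \<in> out_arcs G (fst x) \<Longrightarrow> (head G a, snd x + arc_chain a) \<in> T"
      using that B'_B step by (auto simp: J_def T_def)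
    have "(\<Sum>y\<in>T. K x y * H y) = (\<Sum>a\<in>out_arcs G (fst x). \<Sum>y\<in>T.
         if y = (head G a, snd x + arc_chain a) then w a * H y else 0)
       + (\<Sum>y\<in>T. if y = x then (of_real (q (fst x)) - l) * H y else 0)"
      unfolding K_def distrib_right sum.distrib sum_distrib_right
      by (subst sum.swap) (auto intro!: arg_cong2[where f="(+)"] sum.cong)
    then show ?thesis using x fin by (simp add: sum.delta)
  qed
  have indep: "\<forall>g. (\<forall>y\<in>T. (\<Sum>x\<in>J. g x * K x y) = 0) \<longrightarrow> (\<forall>x\<in>J. g x = 0)"
  proof (intro allI impI ballI)
    fix g x assume g: "\<forall>y\<in>T. (\<Sum>x\<in>J. g x * K x y) = 0" and x: "x \<in> J"
    interpret adj: weighted_multigraph G r h "\<lambda>a. w (r a)" q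
      by unfold_locales (simp_all add: w_arev w_nonzero)
    \<comment> \<open>a relation between the equations, read as a finitely supported function; it solves the equation
      of the transposed operator, whose weights are \<open>w (r a)\<close>\<close>
    define g' where "g' u c = (if c \<in> B' then g (u, c) else 0)" for u c
    have "g' (fst x) (snd x) = 0"
    proof (rule adj.finitely_supported_no_eigenfunction[OF deg d])
      show "finite {c. g' u c \<noteq> 0}" for u
        by (rule finite_subset[OF _ fin(2)]) (auto simp: g'_def)
    next
      fix u c assume u: "u \<in> verts G"
      \<comment> \<open>outside the box every coefficient vanishes since interior points have their neighbours in the box\<close>
      have "(\<Sum>x\<in>J. g x * K x (u, c)) = 0"
      proof (cases "c \<in> B")
        case True then show ?thesis using g u by (simp add: T_def)
      next
        case False
        have "K x (u, c) = 0" if "x \<in> J" for x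
        proof -
          have "c \<noteq> snd x" "\<And>a. a \<in> arcs G \<Longrightarrow> c \<noteq> snd x + arc_chain a"
            using that B'_B step False by (auto simp: J_def)
          then show ?thesis by (auto simp: K_def intro!: sum.neutral)
        qed
        then show ?thesis by simp
      qed
      moreover have "(\<Sum>x\<in>J. g x * K x (u, c))
          = (\<Sum>a\<in>out_arcs G u. w (r a) * g' (head G a) (c + arc_chain a)) + (of_real (q u) - l) * g' u c"
      proof -
        have "(\<Sum>x\<in>J. g x * K x (u, c))
          = (\<Sum>u'\<in>verts G. \<Sum>c'\<in>B'. \<Sum>a\<in>out_arcs G u'. if c' = c - arc_chain a then (if head G a = u then w a * g (u', c') else 0) else 0)
           + (\<Sum>u'\<in>verts G. \<Sum>c'\<in>B'. if c' = c then (if u' = u then (of_real (q u) - l) * g (u', c') else 0) else 0)"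
          unfolding J_def sum.cartesian_product' sum.distrib[symmetric]
          by (intro sum.cong refl)
            (auto simp: K_def distrib_left sum_distrib_left algebra_simps
              intro!: arg_cong2[where f="(+)"] sum.cong)
        also have "(\<Sum>u'\<in>verts G. \<Sum>c'\<in>B'. \<Sum>a\<in>out_arcs G u'. if c' = c - arc_chain a then (if head G a = u then w a * g (u', c') else 0) else 0)
           = (\<Sum>u'\<in>verts G. \<Sum>a\<in>out_arcs G u'. if head G a = u then w a * g' (tail G a) (c - arc_chain a) else 0)"
          using fin(2) by (subst sum.swap) (auto simp: g'_def sum.delta intro!: sum.cong)
        also have "\<dots> = (\<Sum>a | a \<in> arcs G \<and> head G a = u. w a * g' (tail G a) (c - arc_chain a))"
          by (subst sum_out_arcs) (simp add: sum.inter_filter)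
        also have "\<dots> = (\<Sum>a | a \<in> arcs G \<and> tail G a = u. w (r a) * g' (tail G (r a)) (c - arc_chain (r a)))"
          by (rule sum_arcs_rev) simp
        also have "\<dots> = (\<Sum>a\<in>out_arcs G u. w (r a) * g' (head G a) (c + arc_chain a))"
          by (intro sum.cong) (auto simp: arc_chain_arev)
        also have "(\<Sum>u'\<in>verts G. \<Sum>c'\<in>B'. if c' = c then (if u' = u then (of_real (q u) - l) * g (u', c') else 0) else 0)
           = (of_real (q u) - l) * g' u c"
          using fin(2) u by (simp add: sum.delta g'_def)
        finally show ?thesis .
      qed
      ultimately show "(\<Sum>a\<in>out_arcs G u. w (r a) * g' (head G a) (c + arc_chain a)) + of_real (q u) * g' u c = l * g' u c"
        by (simp add: algebra_simps)
    qed (use x in \<open>auto simp: J_def\<close>)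
    then show "g x = 0" using x by (auto simp: g'_def J_def)
  qed
  obtain \<rho> where \<rho>: "\<And>y. 0 \<le> \<rho> y" "(\<Sum>y\<in>T. \<rho> y) = real (card T) - real (card J)"
    "\<And>H y. (\<And>x. x \<in> J \<Longrightarrow> (\<Sum>y\<in>T. K x y * H y) = 0) \<Longrightarrow> y \<in> T \<Longrightarrow>
       (cmod (H y))\<^sup>2 \<le> \<rho> y * (\<Sum>z\<in>T. (cmod (H z))\<^sup>2)"
    using leverage_scores[OF fin(4,3) indep] by blast
  have M: "0 \<le> M" using bound[of "{}"] by simp
  have pointwise: "(cmod (F v c0))\<^sup>2 \<le> \<rho> (v, c) * M" if c: "c \<in> B" for c
  proof -
    \<comment> \<open>the translate that brings the value \<open>F v c0\<close> to the point \<open>(v, c)\<close>\<close>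
    define H where "H y = F (fst y) (snd y + (c0 - c))" for y
    have "(\<Sum>y\<in>T. K x y * H y) = 0" if "x \<in> J" for x
      using eig[of "fst x" "snd x + (c0 - c)"] that
      by (simp add: K_apply H_def J_def mem_Times_iff algebra_simps)
    then have "(cmod (H (v, c)))\<^sup>2 \<le> \<rho> (v, c) * (\<Sum>z\<in>T. (cmod (H z))\<^sup>2)"
      using v c by (intro \<rho>(3)) (auto simp: T_def)
    also have "(\<Sum>z\<in>T. (cmod (H z))\<^sup>2)
        = (\<Sum>z\<in>(\<lambda>y. (fst y, snd y + (c0 - c))) ` T. (cmod (F (fst z) (snd z)))\<^sup>2)"
      by (subst sum.reindex) (auto simp: inj_on_def H_def prod_eq_iff)
    also have "\<dots> \<le> M" using fin(3) by (intro bound) (auto simp: T_def)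
    finally show ?thesis using \<rho>(1) by (simp add: H_def mult_left_mono)
  qed
  have "real N ^ m * (cmod (F v c0))\<^sup>2 = (\<Sum>c\<in>B. (cmod (F v c0))\<^sup>2)"
    by (simp add: card_B)
  also have "\<dots> \<le> (\<Sum>c\<in>B. \<rho> (v, c) * M)" by (rule sum_mono) (rule pointwise)
  also have "\<dots> = (\<Sum>y\<in>{v} \<times> B. \<rho> y) * M"
    by (simp add: sum_distrib_right sum.cartesian_product')
  also have "\<dots> \<le> (\<Sum>y\<in>T. \<rho> y) * M"
    using v fin M \<rho>(1) by (intro mult_right_mono sum_mono2) (auto simp: T_def)
  also have "\<dots> = M * (card (verts G) * (real N ^ m - real (N - 2) ^ m))"
    unfolding \<rho>(2) by (simp add: T_def J_def card_cartesian_product card_B algebra_simps)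
  finally show ?thesis .
qed

text \<open>Let the side of the box tend to infinity in \<open>box_estimate\<close>.\<close>

theorem no_square_summable_eigenfunction:
  fixes F :: "'v \<Rightarrow> (nat \<Rightarrow>\<^sub>0 int) \<Rightarrow> complex"
  assumes deg: "\<And>v. v \<in> verts G \<Longrightarrow> out_degree G v = d" and d: "2 \<le> d"
    and bound: "\<And>A. finite A \<Longrightarrow> A \<subseteq> verts G \<times> UNIV \<Longrightarrow> (\<Sum>y\<in>A. (cmod (F (fst y) (snd y)))\<^sup>2) \<le> M"
    and eig: "\<And>u c. u \<in> verts G \<Longrightarrow>
      (\<Sum>a\<in>out_arcs G u. w a * F (head G a) (c + arc_chain a)) + q u * F u c = l * F u c"
    and v: "v \<in> verts G"
  shows "F v c = 0"
proof -
  obtain m where m: "\<And>a. a \<in> arcs G \<Longrightarrow> edge_index a < m"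
    using finite_nat_set_iff_bounded[of "edge_index ` arcs G"] by auto
  define C where "C = M * card (verts G)"
  have "(cmod (F v c))\<^sup>2 \<le> C * (1 - (1 - 2 * inverse (real (Suc N))) ^ m)" if "N \<ge> 1" for N
  proof -
    have "real (Suc N) ^ m * (cmod (F v c))\<^sup>2
        \<le> M * (card (verts G) * (real (Suc N) ^ m - real (Suc N - 2) ^ m))"
      using box_estimate[OF deg d bound eig v m, of "Suc N" c] that by simp
    also have "\<dots> = real (Suc N) ^ m * (C * (1 - (1 - 2 * inverse (real (Suc N))) ^ m))"
    proof -
      have "real (Suc N - 2) = real (Suc N) * (1 - 2 * inverse (real (Suc N)))"
        using that by (simp add: field_simps of_nat_diff)
      then show ?thesis by (simp only: C_def power_mult_distrib) (simp add: algebra_simps)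
    qed
    finally show ?thesis by (simp only: mult_le_cancel_left_pos zero_less_power of_nat_0_less_iff zero_less_Suc)
  qed
  moreover have "(\<lambda>N. C * (1 - (1 - 2 * inverse (real (Suc N))) ^ m)) \<longlonglongrightarrow> C * (1 - (1 - 2 * 0) ^ m)"
    by (intro tendsto_intros LIMSEQ_inverse_real_of_nat)
  ultimately have "(cmod (F v c))\<^sup>2 \<le> C * (1 - (1 - 2 * 0) ^ m)"
    by (intro LIMSEQ_le_const) (auto intro!: exI[of _ 1])
  then show ?thesis by simp
qed

end

section \<open>Walks, chains and the commutator subgroup\<close>

context oriented_multigraph
begin

lemma reduce_Nil [simp]: "reduce r [] = []"
  by (simp add: reduce_def)

lemma reduce_Cons [simp]: "reduce r (a # p) = cancel_cons r a (reduce r p)"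
  by (simp add: reduce_def)

lemma reduced_cancel_cons: "reduced r p \<Longrightarrow> reduced r (cancel_cons r a p)"
  by (cases p) (auto simp: reduced_def cancel_cons_def successively_Cons)

lemma reduced_reduce: "reduced r (reduce r p)"
  by (induction p) (simp add: reduced_def, simp add: reduced_cancel_cons)

lemma reduce_reduced: "reduced r p \<Longrightarrow> reduce r p = p"
proof (induction p)
  case (Cons a p)
  then have "reduce r p = p" by (cases p) (auto simp: reduced_def)
  then show ?case using Cons.prems by (cases p) (auto simp: reduced_def cancel_cons_def)
qed simp

lemma cancel_cons_cancel_cons:
  assumes "reduced r p"
  shows "cancel_cons r a (cancel_cons r (r a) p) = p"
  using assms
  by (cases p) (auto simp: cancel_cons_def reduced_def successively_Cons split: list.splits)

text \<open>Cancelling a pair inside \<open>s\<close> does not change the effect of prefixing \<open>s\<close> letter by letter to a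
  reduced walk.  This is the confluence of free reduction.\<close>

lemma foldr_cancel_cons:
  assumes "reduced r t"
  shows "reduced r (foldr (cancel_cons r) s t)"
    and "foldr (cancel_cons r) (cancel_cons r a s) t = cancel_cons r a (foldr (cancel_cons r) s t)"
proof -
  show red: "reduced r (foldr (cancel_cons r) s t)" for s
    using assms by (induction s) (auto intro: reduced_cancel_cons)
  show "foldr (cancel_cons r) (cancel_cons r a s) t = cancel_cons r a (foldr (cancel_cons r) s t)"
  proof (cases s)
    case (Cons b s')
    show ?thesis
    proof (cases "b = r a")
      case True
      then have "cancel_cons r a s = s'" using Cons by (simp add: cancel_cons_def)
      then show ?thesis using Cons True cancel_cons_cancel_cons[OF red, of a s'] by simp
    next
      case False
      then have "cancel_cons r a s = a # s" using Cons by (simp add: cancel_cons_def)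
      then show ?thesis by simp
    qed
  qed (simp add: cancel_cons_def)
qed

lemma reduce_append: "reduce r (p @ q) = foldr (cancel_cons r) p (reduce r q)"
  by (simp add: reduce_def)

lemma reduce_append_reduce_left [simp]: "reduce r (reduce r p @ q) = reduce r (p @ q)"
proof (induction p)
  case (Cons a p)
  have "reduce r (reduce r (a # p) @ q)
      = foldr (cancel_cons r) (cancel_cons r a (reduce r p)) (reduce r q)"
    by (simp add: reduce_append)
  also have "\<dots> = cancel_cons r a (reduce r (reduce r p @ q))"
    by (simp add: foldr_cancel_cons reduced_reduce reduce_append)
  finally show ?case using Cons by simp
qed simp

lemma reduce_append_reduce_right [simp]: "reduce r (p @ reduce r q) = reduce r (p @ q)"
  by (simp add: reduce_append reduce_reduced reduced_reduce)

definition inv_walk :: "'e list \<Rightarrow> 'e list" where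
  "inv_walk p = rev (map r p)"

lemma inv_walk_inv_walk [simp]: "inv_walk (inv_walk p) = p"
  by (simp add: inv_walk_def rev_map comp_def)

lemma reduce_inv_walk_right: "reduce r (p @ inv_walk p) = []"
proof (induction p)
  case (Cons a p)
  have "reduce r ((a # p) @ inv_walk (a # p)) = cancel_cons r a (reduce r ((p @ inv_walk p) @ [r a]))"
    by (simp add: inv_walk_def)
  also have "reduce r ((p @ inv_walk p) @ [r a]) = reduce r (reduce r (p @ inv_walk p) @ [r a])"
    by (simp only: reduce_append_reduce_left)
  also have "\<dots> = [r a]" using Cons by (simp add: cancel_cons_def)
  finally show ?case by (simp add: cancel_cons_def)
qed (simp add: inv_walk_def)

lemma reduce_inv_walk_left: "reduce r (inv_walk p @ p) = []"
  using reduce_inv_walk_right[of "inv_walk p"] by simp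

lemma reduce_cancel_middle:
  "reduce r (p @ s) = [] \<Longrightarrow> reduce r (x @ p @ s @ y) = reduce r (x @ y)"
proof -
  assume *: "reduce r (p @ s) = []"
  have "reduce r (x @ p @ s @ y) = reduce r (x @ reduce r ((p @ s) @ y))"
    by (simp only: reduce_append_reduce_right append.assoc)
  also have "reduce r ((p @ s) @ y) = reduce r (reduce r (p @ s) @ y)"
    by (simp only: reduce_append_reduce_left)
  finally show ?thesis by (simp add: *)
qed

lemma awalk_cancel_cons:
  assumes "a \<in> arcs G" "awalk (head G a) p v"
  shows "awalk (tail G a) (cancel_cons r a p) v"
  using assms by (cases p) (auto simp: cancel_cons_def awalk_simps)

lemma awalk_reduce: "awalk u p v \<Longrightarrow> awalk u (reduce r p) v"
  by (induction p arbitrary: u) (auto simp: awalk_simps intro: awalk_cancel_cons)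

lemma awalk_inv_walk: "awalk u p v \<Longrightarrow> awalk v (inv_walk p) u"
proof (induction p arbitrary: u)
  case (Cons a p)
  then have "awalk v (inv_walk p) (head G a)" "awalk (head G a) [r a] u"
    by (auto simp: awalk_simps)
  then show ?case by (auto simp: inv_walk_def simp del: awalk_append_iff intro: awalk_appendI)
qed (simp add: inv_walk_def awalk_simps)

definition chain :: "'e list \<Rightarrow> nat \<Rightarrow>\<^sub>0 int" where
  "chain p = sum_list (map arc_chain p)"

lemma chain_simps [simp]:
  "chain [] = 0" "chain (a # p) = arc_chain a + chain p" "chain (p @ p') = chain p + chain p'"
  by (simp_all add: chain_def)

lemma chain_cancel_cons: "a \<in> arcs G \<Longrightarrow> chain (cancel_cons r a p) = arc_chain a + chain p"
  by (cases p) (auto simp: cancel_cons_def arc_chain_arev)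

lemma chain_reduce: "set p \<subseteq> arcs G \<Longrightarrow> chain (reduce r p) = chain p"
  by (induction p) (auto simp: chain_cancel_cons)

lemma chain_inv_walk: "set p \<subseteq> arcs G \<Longrightarrow> chain (inv_walk p) = - chain p"
  by (induction p) (auto simp: inv_walk_def arc_chain_arev)

text \<open>Otherwise all contributions to the coefficient of the edge of \<open>a\<close> have the same sign.\<close>

lemma chain_zero_cancels:
  assumes "set (a # p) \<subseteq> arcs G" "chain (a # p) = 0"
  shows "r a \<in> set p"
proof (rule ccontr)
  assume no: "r a \<notin> set p"
  define s :: int where "s = (if h a < h (r a) then 1 else - 1)"
  have "0 \<le> s * Poly_Mapping.lookup (chain p) (edge_index a)"
    using no assms(1)
  proof (induction p)
    case (Cons b p)
    have "0 \<le> s * Poly_Mapping.lookup (arc_chain b) (edge_index a)"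
    proof (cases "edge_index b = edge_index a")
      case True
      then have "b = a" using edge_index_eq[of b a] Cons.prems by auto
      then show ?thesis by (simp add: arc_chain_def s_def)
    next
      case False
      then show ?thesis by (simp add: arc_chain_def lookup_single)
    qed
    then show ?case using Cons by (simp add: lookup_add distrib_left)
  qed simp
  moreover have "s * Poly_Mapping.lookup (arc_chain a) (edge_index a) = 1"
    by (simp add: arc_chain_def s_def)
  ultimately have "0 < s * Poly_Mapping.lookup (chain (a # p)) (edge_index a)"
    by (simp add: lookup_add distrib_left)
  then show False using assms(2) by simp
qed

context
  fixes v0 :: 'v
  assumes v0: "v0 \<in> verts G"
begin

abbreviation \<pi>\<^sub>1 :: "'e list monoid" where "\<pi>\<^sub>1 \<equiv> fundamental_group G r v0"

lemma reduced_walks_iff: "p \<in> reduced_walks G r u v \<longleftrightarrow> awalk u p v \<and> reduced r p"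
  by (simp add: reduced_walks_def)

lemma reduce_in_reduced_walks: "awalk u p v \<Longrightarrow> reduce r p \<in> reduced_walks G r u v"
  by (simp add: reduced_walks_iff awalk_reduce reduced_reduce)

lemma pi_simps: "carrier \<pi>\<^sub>1 = reduced_walks G r v0 v0" "x \<otimes>\<^bsub>\<pi>\<^sub>1\<^esub> y = reduce r (x @ y)" "\<one>\<^bsub>\<pi>\<^sub>1\<^esub> = []"
  by (simp_all add: fundamental_group_def)

lemma group_pi: "group \<pi>\<^sub>1"
proof (rule groupI)
  fix x y z assume "x \<in> carrier \<pi>\<^sub>1" "y \<in> carrier \<pi>\<^sub>1"
  then show "x \<otimes>\<^bsub>\<pi>\<^sub>1\<^esub> y \<in> carrier \<pi>\<^sub>1"
    by (auto simp: pi_simps reduced_walks_iff simp del: awalk_append_iff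
        intro!: reduce_in_reduced_walks[unfolded reduced_walks_iff] awalk_appendI)
next
  fix x assume x: "x \<in> carrier \<pi>\<^sub>1"
  then have "reduce r (inv_walk x) \<in> carrier \<pi>\<^sub>1"
    by (auto simp: pi_simps reduced_walks_iff intro!: awalk_reduce awalk_inv_walk reduced_reduce)
  moreover have "reduce r (inv_walk x) \<otimes>\<^bsub>\<pi>\<^sub>1\<^esub> x = \<one>\<^bsub>\<pi>\<^sub>1\<^esub>"
    by (simp add: pi_simps reduce_inv_walk_left)
  ultimately show "\<exists>y\<in>carrier \<pi>\<^sub>1. y \<otimes>\<^bsub>\<pi>\<^sub>1\<^esub> x = \<one>\<^bsub>\<pi>\<^sub>1\<^esub>" by blast
qed (use v0 in \<open>auto simp: pi_simps reduced_walks_iff awalk_simps reduced_def[of r "[]"]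
      reduce_reduced\<close>)

interpretation \<pi>: group \<pi>\<^sub>1 by (rule group_pi)

lemma chain_mult: "x \<in> carrier \<pi>\<^sub>1 \<Longrightarrow> y \<in> carrier \<pi>\<^sub>1 \<Longrightarrow> chain (x \<otimes>\<^bsub>\<pi>\<^sub>1\<^esub> y) = chain x + chain y"
  by (auto simp: pi_simps reduced_walks_iff awalk_def chain_reduce)

lemma chain_inv: "x \<in> carrier \<pi>\<^sub>1 \<Longrightarrow> chain (inv\<^bsub>\<pi>\<^sub>1\<^esub> x) = - chain x"
  using chain_mult[of "inv\<^bsub>\<pi>\<^sub>1\<^esub> x" x] by (simp add: pi_simps(3) add_eq_0_iff2)

lemma chain_derived:
  assumes "x \<in> derived \<pi>\<^sub>1 (carrier \<pi>\<^sub>1)"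
  shows "chain x = 0"
proof -
  have sub: "derived_set \<pi>\<^sub>1 (carrier \<pi>\<^sub>1) \<subseteq> carrier \<pi>\<^sub>1"
    by (rule \<pi>.derived_set_in_carrier) simp
  have *: "chain y = 0" if "y \<in> derived_set \<pi>\<^sub>1 (carrier \<pi>\<^sub>1)" for y
    using that by (auto simp: chain_mult chain_inv)
  from assms show ?thesis
    unfolding derived_def
  proof (induction rule: generate.induct)
    case (inv y)
    then have "y \<in> carrier \<pi>\<^sub>1" using sub by (rule rev_subsetD)
    then show ?case using chain_inv *[OF inv] by simp
  next
    case (eng y z)
    then have "y \<in> carrier \<pi>\<^sub>1" "z \<in> carrier \<pi>\<^sub>1"
      using \<pi>.generate_in_carrier[OF sub] by blast+
    then show ?case using eng by (simp add: chain_mult)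
  qed (use * in \<open>auto simp: pi_simps(3)\<close>)
qed

definition reachable_arcs :: "'e set" where
  "reachable_arcs = {a \<in> arcs G. \<exists>p. awalk v0 p (tail G a)}"

text \<open>At the base point the walk must be empty, so that \<open>word\<close> gives back a closed walk itself and not
  a conjugate of it.\<close>

definition approach :: "'v \<Rightarrow> 'e list" where
  "approach v = (if v = v0 then [] else SOME p. awalk v0 p v)"

text \<open>These loops generate the fundamental group; the approach walks take the place of a spanning tree.\<close>

definition loop_of_arc :: "'e \<Rightarrow> 'e list" where
  "loop_of_arc a = reduce r (approach (tail G a) @ a # inv_walk (approach (head G a)))"

definition word :: "'e list \<Rightarrow> 'e list" where
  "word p = foldr (\<lambda>a x. loop_of_arc a \<otimes>\<^bsub>\<pi>\<^sub>1\<^esub> x) p \<one>\<^bsub>\<pi>\<^sub>1\<^esub>"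

lemma approach_awalk: "awalk v0 p v \<Longrightarrow> awalk v0 (approach v) v"
  using v0 someI[of "\<lambda>p. awalk v0 p v" p] by (auto simp: approach_def awalk_simps)

lemma reachable_arcs_head:
  assumes "a \<in> reachable_arcs"
  shows "\<exists>p. awalk v0 p (head G a)"
proof -
  obtain p where "awalk v0 p (tail G a)" "a \<in> arcs G" using assms by (auto simp: reachable_arcs_def)
  then have "awalk v0 (p @ [a]) (head G a)" by (auto simp: awalk_simps)
  then show ?thesis by blast
qed

lemma loop_of_arc_closed: "a \<in> reachable_arcs \<Longrightarrow> loop_of_arc a \<in> carrier \<pi>\<^sub>1"
proof -
  assume a: "a \<in> reachable_arcs"
  obtain p p' where p: "awalk v0 p (tail G a)" "awalk v0 p' (head G a)" "a \<in> arcs G"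
    using a reachable_arcs_head[OF a] by (auto simp: reachable_arcs_def)
  have "awalk v0 (approach (tail G a) @ [a] @ inv_walk (approach (head G a))) v0"
    using approach_awalk[OF p(1)] awalk_inv_walk[OF approach_awalk[OF p(2)]] p(3)
    by (intro awalk_appendI) (auto simp: awalk_simps)
  then show ?thesis unfolding loop_of_arc_def pi_simps by (intro reduce_in_reduced_walks) simp
qed

lemma reachable_arcs_arev: "a \<in> reachable_arcs \<Longrightarrow> r a \<in> reachable_arcs"
  using reachable_arcs_head[of a] by (auto simp: reachable_arcs_def)

lemma loop_of_arc_arev:
  assumes "a \<in> reachable_arcs"
  shows "loop_of_arc (r a) = inv\<^bsub>\<pi>\<^sub>1\<^esub> loop_of_arc a"
proof (rule \<pi>.inv_equality[symmetric])
  have a: "a \<in> arcs G" using assms by (simp add: reachable_arcs_def)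
  define s where "s = approach (tail G a) @ a # inv_walk (approach (head G a))"
  have "inv_walk s = approach (head G a) @ r a # inv_walk (approach (tail G a))"
    by (simp add: s_def inv_walk_def rev_map comp_def)
  then have "loop_of_arc (r a) = reduce r (inv_walk s)" using a by (simp add: loop_of_arc_def)
  moreover have "loop_of_arc a = reduce r s" by (simp add: loop_of_arc_def s_def)
  ultimately show "loop_of_arc (r a) \<otimes>\<^bsub>\<pi>\<^sub>1\<^esub> loop_of_arc a = \<one>\<^bsub>\<pi>\<^sub>1\<^esub>"
    by (simp add: pi_simps reduce_inv_walk_left)
qed (use assms reachable_arcs_arev in \<open>auto intro: loop_of_arc_closed\<close>)

lemma word_simps [simp]: "word [] = \<one>\<^bsub>\<pi>\<^sub>1\<^esub>" "word (a # p) = loop_of_arc a \<otimes>\<^bsub>\<pi>\<^sub>1\<^esub> word p"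
  by (simp_all add: word_def)

lemma word_closed: "set p \<subseteq> reachable_arcs \<Longrightarrow> word p \<in> carrier \<pi>\<^sub>1"
  by (induction p) (auto simp: loop_of_arc_closed)

lemma word_append:
  "set p \<subseteq> reachable_arcs \<Longrightarrow> set p' \<subseteq> reachable_arcs \<Longrightarrow> word (p @ p') = word p \<otimes>\<^bsub>\<pi>\<^sub>1\<^esub> word p'"
  by (induction p) (auto simp: loop_of_arc_closed word_closed \<pi>.m_assoc)

text \<open>Consecutive loops meet in a walk to the common vertex and back, which cancels.\<close>

lemma word_walk:
  assumes "awalk u p v" "awalk v0 s u"
  shows "set p \<subseteq> reachable_arcs \<and> word p = reduce r (approach u @ p @ inv_walk (approach v))"
  using assms
proof (induction p arbitrary: u s)
  case Nil
  then show ?case by (auto simp: awalk_simps pi_simps reduce_inv_walk_right)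
next
  case (Cons a p)
  then have a: "a \<in> arcs G" "tail G a = u" "awalk (head G a) p v" by (auto simp: awalk_simps)
  then have "awalk v0 (s @ [a]) (head G a)" using Cons.prems(2) by (auto simp: awalk_simps)
  note Cons.IH[OF a(3) this]
  then have IH: "set p \<subseteq> reachable_arcs" "word p = reduce r (approach (head G a) @ p @ inv_walk (approach v))"
    by auto
  have "word (a # p) = reduce r ((approach u @ [a]) @ inv_walk (approach (head G a)) @
      approach (head G a) @ p @ inv_walk (approach v))"
    using a IH(2) by (simp add: loop_of_arc_def pi_simps)
  also have "\<dots> = reduce r ((approach u @ [a]) @ p @ inv_walk (approach v))"
    by (rule reduce_cancel_middle) (rule reduce_inv_walk_left)
  finally show ?case using IH a Cons.prems(2) by (auto simp: reachable_arcs_def)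
qed

text \<open>The first letter and a later occurrence of its inverse are removed at the cost of a commutator,
  and the rest is balanced and shorter.\<close>

lemma balanced_word_derived:
  assumes "set p \<subseteq> reachable_arcs" "chain p = 0"
  shows "word p \<in> derived \<pi>\<^sub>1 (carrier \<pi>\<^sub>1)"
  using assms
proof (induction p rule: length_induct)
  case (1 p)
  interpret D: subgroup "derived \<pi>\<^sub>1 (carrier \<pi>\<^sub>1)" \<pi>\<^sub>1
    by (rule \<pi>.derived_is_subgroup) simp
  show ?case
  proof (cases p)
    case Nil
    then show ?thesis using D.one_closed by simp
  next
    case (Cons a xs)
    have sub: "reachable_arcs \<subseteq> arcs G" by (auto simp: reachable_arcs_def)
    then have "r a \<in> set xs" using "1.prems" Cons chain_zero_cancels[of a xs] by auto
    then obtain ys zs where xs: "xs = ys @ r a # zs" by (auto dest: split_list)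
    have R: "a \<in> reachable_arcs" "set ys \<subseteq> reachable_arcs" "set zs \<subseteq> reachable_arcs"
      using "1.prems" Cons xs by auto
    define A where "A = loop_of_arc a"
    define Y where "Y = word ys"
    define Z where "Z = word zs"
    have cl: "A \<in> carrier \<pi>\<^sub>1" "Y \<in> carrier \<pi>\<^sub>1" "Z \<in> carrier \<pi>\<^sub>1"
      using R by (auto simp: A_def Y_def Z_def loop_of_arc_closed word_closed)
    have "chain (ys @ zs) = 0"
      using "1.prems"(2) Cons xs R(1) sub by (auto simp: arc_chain_arev algebra_simps)
    moreover have "length (ys @ zs) < length p" by (simp add: Cons xs)
    ultimately have IH: "Y \<otimes>\<^bsub>\<pi>\<^sub>1\<^esub> Z \<in> derived \<pi>\<^sub>1 (carrier \<pi>\<^sub>1)"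
      using "1.IH" R by (auto simp: Y_def Z_def simp flip: word_append)
    have comm: "A \<otimes>\<^bsub>\<pi>\<^sub>1\<^esub> Y \<otimes>\<^bsub>\<pi>\<^sub>1\<^esub> inv\<^bsub>\<pi>\<^sub>1\<^esub> A \<otimes>\<^bsub>\<pi>\<^sub>1\<^esub> inv\<^bsub>\<pi>\<^sub>1\<^esub> Y \<in> derived \<pi>\<^sub>1 (carrier \<pi>\<^sub>1)"
      unfolding derived_def using cl by (intro generate.incl) blast
    have "word p = A \<otimes>\<^bsub>\<pi>\<^sub>1\<^esub> (Y \<otimes>\<^bsub>\<pi>\<^sub>1\<^esub> (inv\<^bsub>\<pi>\<^sub>1\<^esub> A \<otimes>\<^bsub>\<pi>\<^sub>1\<^esub> Z))"
      using R reachable_arcs_arev[OF R(1)]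
      by (simp add: Cons xs word_append loop_of_arc_arev A_def Y_def Z_def)
    also have "\<dots> = (A \<otimes>\<^bsub>\<pi>\<^sub>1\<^esub> Y \<otimes>\<^bsub>\<pi>\<^sub>1\<^esub> inv\<^bsub>\<pi>\<^sub>1\<^esub> A \<otimes>\<^bsub>\<pi>\<^sub>1\<^esub> inv\<^bsub>\<pi>\<^sub>1\<^esub> Y) \<otimes>\<^bsub>\<pi>\<^sub>1\<^esub> (Y \<otimes>\<^bsub>\<pi>\<^sub>1\<^esub> Z)"
      using cl \<pi>.inv_solve_left[of "inv\<^bsub>\<pi>\<^sub>1\<^esub> Y"]
      by (simp add: \<pi>.m_assoc \<pi>.l_inv_ex) (simp add: \<pi>.m_assoc[symmetric])
    finally show ?thesis using comm IH by simp
  qed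
qed

text \<open>The abelianisation of the fundamental group is the first homology group, which embeds in the group
  of chains.\<close>

lemma derived_pi:
  "derived \<pi>\<^sub>1 (carrier \<pi>\<^sub>1) = {p \<in> reduced_walks G r v0 v0. chain p = 0}"
proof (intro equalityI subsetI)
  fix p assume p: "p \<in> derived \<pi>\<^sub>1 (carrier \<pi>\<^sub>1)"
  then have "p \<in> carrier \<pi>\<^sub>1" using \<pi>.derived_in_carrier by blast
  then show "p \<in> {p \<in> reduced_walks G r v0 v0. chain p = 0}"
    using chain_derived[OF p] by (simp add: pi_simps)
next
  fix p assume "p \<in> {p \<in> reduced_walks G r v0 v0. chain p = 0}"
  then have p: "awalk v0 p v0" "reduced r p" "chain p = 0" by (auto simp: reduced_walks_iff)
  have "set p \<subseteq> reachable_arcs \<and> word p = p"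
    using word_walk[OF p(1), of "[]"] v0 p(2)
    by (simp add: approach_def awalk_simps inv_walk_def reduce_reduced)
  then show "p \<in> derived \<pi>\<^sub>1 (carrier \<pi>\<^sub>1)"
    using balanced_word_derived[of p] p(3) by simp
qed

section \<open>The maximal abelian cover in terms of chains\<close>

text \<open>The walks that represent one vertex of the maximal abelian cover, namely the vertex over \<open>v\<close>
  that is reached from the base point with net edge count \<open>c\<close>.\<close>

definition fibre :: "'v \<Rightarrow> (nat \<Rightarrow>\<^sub>0 int) \<Rightarrow> 'e list set" where
  "fibre v c = {p \<in> reduced_walks G r v0 v. chain p = c}"

text \<open>Two walks with the same end and the same chain differ by a closed walk with zero chain, that is,
  by an element of the commutator subgroup.\<close>

lemma orbit_vert:
  assumes p: "p \<in> fibre v c"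
  shows "Group_Action.orbit (commutator_subgroup \<pi>\<^sub>1) (deck_vert r) p = fibre v c"
proof (intro equalityI subsetI)
  fix x assume "x \<in> Group_Action.orbit (commutator_subgroup \<pi>\<^sub>1) (deck_vert r) p"
  then obtain g where "g \<in> derived \<pi>\<^sub>1 (carrier \<pi>\<^sub>1)" and x: "x = reduce r (g @ p)"
    by (auto simp: Group_Action.orbit_def commutator_subgroup_def deck_vert_def)
  then have g: "awalk v0 g v0" "chain g = 0" by (auto simp: derived_pi reduced_walks_iff)
  have p': "awalk v0 p v" "chain p = c" using p by (auto simp: fibre_def reduced_walks_iff)
  have gp: "awalk v0 (g @ p) v" using g(1) p'(1) by (rule awalk_appendI)
  then have "chain x = c" using g p' by (auto simp: x chain_reduce awalk_def)
  then show "x \<in> fibre v c" using reduce_in_reduced_walks[OF gp] by (simp add: fibre_def x)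
next
  fix x assume x: "x \<in> fibre v c"
  have p': "awalk v0 p v" "reduced r p" "chain p = c" using p by (auto simp: fibre_def reduced_walks_iff)
  have x': "awalk v0 x v" "reduced r x" "chain x = c" using x by (auto simp: fibre_def reduced_walks_iff)
  define g where "g = reduce r (x @ inv_walk p)"
  have w: "awalk v0 (x @ inv_walk p) v0" using x'(1) awalk_inv_walk[OF p'(1)] by (rule awalk_appendI)
  moreover have "set p \<subseteq> arcs G" using p'(1) by (simp add: awalk_def)
  moreover have "set (x @ inv_walk p) \<subseteq> arcs G" using w unfolding awalk_def by blast
  ultimately have "g \<in> derived \<pi>\<^sub>1 (carrier \<pi>\<^sub>1)"
    using reduce_in_reduced_walks[OF w] x'(3) p'(3)
    by (simp add: derived_pi g_def chain_reduce chain_inv_walk)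
  moreover have "deck_vert r g p = x"
  proof -
    have "deck_vert r g p = reduce r (x @ inv_walk p @ p @ [])"
      by (simp add: deck_vert_def g_def)
    also have "\<dots> = reduce r (x @ [])"
      by (rule reduce_cancel_middle) (rule reduce_inv_walk_left)
    finally show ?thesis using x'(2) by (simp add: reduce_reduced)
  qed
  ultimately show "x \<in> Group_Action.orbit (commutator_subgroup \<pi>\<^sub>1) (deck_vert r) p"
    by (auto simp: Group_Action.orbit_def commutator_subgroup_def)
qed

lemma orbit_arc:
  assumes "p \<in> fibre v c"
  shows "Group_Action.orbit (commutator_subgroup \<pi>\<^sub>1) (deck_arc r) (p, a) = fibre v c \<times> {a}"
proof -
  have "Group_Action.orbit (commutator_subgroup \<pi>\<^sub>1) (deck_arc r) (p, a)
      = Group_Action.orbit (commutator_subgroup \<pi>\<^sub>1) (deck_vert r) p \<times> {a}"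
    by (auto simp: Group_Action.orbit_def deck_arc_def)
  then show ?thesis by (simp add: orbit_vert[OF assms])
qed

abbreviation Gab :: "('e list set, ('e list \<times> 'e) set) pre_digraph" where
  "Gab \<equiv> max_abelian_cover G r v0"

lemma fibre_chain: "p \<in> reduced_walks G r v0 v \<Longrightarrow> p \<in> fibre v (chain p)"
  by (simp add: fibre_def)

lemma verts_Gab: "verts Gab = {fibre v c | v c. v \<in> verts G \<and> fibre v c \<noteq> {}}"
proof (intro equalityI subsetI)
  fix X assume "X \<in> verts Gab"
  then obtain v p where v: "v \<in> verts G" "p \<in> reduced_walks G r v0 v"
    and X: "X = Group_Action.orbit (commutator_subgroup \<pi>\<^sub>1) (deck_vert r) p"
    by (auto simp: max_abelian_cover_def quotient_graph_def orbits_def universal_cover_def)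
  then show "X \<in> {fibre v c | v c. v \<in> verts G \<and> fibre v c \<noteq> {}}"
    using fibre_chain[OF v(2)] orbit_vert[OF fibre_chain[OF v(2)]] by blast
next
  fix X assume "X \<in> {fibre v c | v c. v \<in> verts G \<and> fibre v c \<noteq> {}}"
  then obtain v c p where v: "v \<in> verts G" and p: "p \<in> fibre v c" and X: "X = fibre v c" by blast
  have "p \<in> reduced_walks G r v0 v" using p by (simp add: fibre_def)
  then show "X \<in> verts Gab"
    using v orbit_vert[OF p] unfolding X
    by (auto simp: max_abelian_cover_def quotient_graph_def orbits_def universal_cover_def)
qed

lemma arcs_Gab:
  "arcs Gab = {fibre v c \<times> {a} | v c a. v \<in> verts G \<and> fibre v c \<noteq> {} \<and> a \<in> out_arcs G v}"
proof (intro equalityI subsetI)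
  fix X assume "X \<in> arcs Gab"
  then obtain v p a where v: "v \<in> verts G" "p \<in> reduced_walks G r v0 v" "a \<in> out_arcs G v"
    and X: "X = Group_Action.orbit (commutator_subgroup \<pi>\<^sub>1) (deck_arc r) (p, a)"
    by (auto simp: max_abelian_cover_def quotient_graph_def orbits_def universal_cover_def)
  then show "X \<in> {fibre v c \<times> {a} | v c a. v \<in> verts G \<and> fibre v c \<noteq> {} \<and> a \<in> out_arcs G v}"
    using fibre_chain[OF v(2)] orbit_arc[OF fibre_chain[OF v(2)], of a] by blast
next
  fix X assume "X \<in> {fibre v c \<times> {a} | v c a. v \<in> verts G \<and> fibre v c \<noteq> {} \<and> a \<in> out_arcs G v}"
  then obtain v c a p where v: "v \<in> verts G" "a \<in> out_arcs G v" and p: "p \<in> fibre v c"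
    and X: "X = fibre v c \<times> {a}" by blast
  have "p \<in> reduced_walks G r v0 v" using p by (simp add: fibre_def)
  then have "(p, a) \<in> arcs (universal_cover G r v0)"
    using v by (auto simp: universal_cover_def)
  then show "X \<in> arcs Gab"
    using orbit_arc[OF p, of a] unfolding X
    by (auto simp: max_abelian_cover_def quotient_graph_def orbits_def)
qed

lemma fibre_eq_iff:
  assumes "fibre v c \<noteq> {}"
  shows "fibre v c = fibre v' c' \<longleftrightarrow> v = v' \<and> c = c'"
proof
  assume eq: "fibre v c = fibre v' c'"
  from assms obtain p where "p \<in> fibre v c" by blast
  then have "awalk v0 p v" "awalk v0 p v'" "chain p = c" "chain p = c'"
    using eq by (auto simp: fibre_def reduced_walks_iff)
  then show "v = v' \<and> c = c'" using awlast_of_awalk[unfolded NOMATCH_def] by blast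
qed simp

lemma extend_fibre:
  assumes "a \<in> arcs G" "p \<in> fibre (tail G a) c"
  shows "reduce r (p @ [a]) \<in> fibre (head G a) (c + arc_chain a)"
proof -
  have "awalk v0 p (tail G a)" "chain p = c" using assms(2) by (auto simp: fibre_def reduced_walks_iff)
  then have w: "awalk v0 (p @ [a]) (head G a)" using assms(1) by (auto simp: awalk_simps)
  then have "set (p @ [a]) \<subseteq> arcs G" unfolding awalk_def by blast
  then show ?thesis
    using reduce_in_reduced_walks[OF w] \<open>chain p = c\<close> by (simp add: fibre_def chain_reduce)
qed

lemma image_extend_fibre:
  assumes a: "a \<in> arcs G"
  shows "(\<lambda>p. reduce r (p @ [a])) ` fibre (tail G a) c = fibre (head G a) (c + arc_chain a)"
proof (intro equalityI subsetI)
  fix x assume x: "x \<in> fibre (head G a) (c + arc_chain a)"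
  define p where "p = reduce r (x @ [r a])"
  have "p \<in> fibre (tail G a) c"
    using extend_fibre[of "r a" x "c + arc_chain a"] a x by (simp add: p_def arc_chain_arev)
  moreover have "reduce r (p @ [a]) = x"
  proof -
    have "reduce r (p @ [a]) = reduce r (x @ [r a] @ [a] @ [])" by (simp add: p_def)
    also have "\<dots> = reduce r (x @ [])"
      by (rule reduce_cancel_middle) (simp add: cancel_cons_def)
    finally show ?thesis using x by (simp add: fibre_def reduced_walks_iff reduce_reduced)
  qed
  ultimately show "x \<in> (\<lambda>p. reduce r (p @ [a])) ` fibre (tail G a) c" by force
qed (use a extend_fibre in auto)

lemma tail_Gab: "fibre v c \<noteq> {} \<Longrightarrow> tail Gab (fibre v c \<times> {a}) = fibre v c"
  by (simp add: max_abelian_cover_def quotient_graph_def universal_cover_def)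

lemma head_Gab:
  assumes "a \<in> out_arcs G v"
  shows "head Gab (fibre v c \<times> {a}) = fibre (head G a) (c + arc_chain a)"
proof -
  have "head Gab (fibre v c \<times> {a}) = (\<lambda>p. reduce r (p @ [a])) ` fibre v c"
    by (auto simp: max_abelian_cover_def quotient_graph_def universal_cover_def image_def)
  then show ?thesis using image_extend_fibre[of a c] assms by simp
qed

lemma ab_proj_vert_fibre: "fibre v c \<noteq> {} \<Longrightarrow> ab_proj_vert G v0 (fibre v c) = v"
proof -
  assume ne: "fibre v c \<noteq> {}"
  have "awlast v0 p = v" if "p \<in> fibre v c" for p
    using that by (auto simp: fibre_def reduced_walks_iff)
  then have "awlast v0 ` fibre v c = {v}" using ne by (auto simp: image_iff)
  then show ?thesis by (simp add: ab_proj_vert_def)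
qed

lemma ab_proj_arc_fibre: "fibre v c \<noteq> {} \<Longrightarrow> ab_proj_arc (fibre v c \<times> {a}) = a"
  by (simp add: ab_proj_arc_def)

text \<open>The lift of the arc \<open>a\<close> at the vertex \<open>(u, c)\<close> leads to \<open>(head G a, c + arc_chain a)\<close>, and
  different arcs have different lifts.\<close>

lemma schroedinger_ab_fibre:
  assumes u: "u \<in> verts G" and ne: "fibre u c \<noteq> {}"
  shows "schroedinger_ab G r v0 w q f (fibre u c)
    = (\<Sum>a\<in>out_arcs G u. w a * f (fibre (head G a) (c + arc_chain a))) + q u * f (fibre u c)"
proof -
  define X where "X = fibre u c"
  define nb where "nb a = fibre (head G a) (c + arc_chain a)" for a
  define S where "S = insert X (nb ` out_arcs G u)"
  define entry where "entry = schroedinger_entry Gab (w \<circ> ab_proj_arc) (q \<circ> ab_proj_vert G v0)"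
  have nb_ne: "nb a \<noteq> {}" if "a \<in> out_arcs G u" for a
    using image_extend_fibre[of a c] that ne by (auto simp: nb_def)
  have finS: "finite S" by (simp add: S_def finite_out_arcs)
  have S: "S \<subseteq> verts Gab"
    unfolding S_def verts_Gab X_def
  proof (intro insert_subsetI image_subsetI)
    fix a assume a: "a \<in> out_arcs G u"
    then have "head G a \<in> verts G" by auto
    then show "nb a \<in> {fibre v c | v c. v \<in> verts G \<and> fibre v c \<noteq> {}}"
      using nb_ne[OF a] unfolding nb_def by blast
  qed (use u ne in blast)
  have entry: "entry X Y = (\<Sum>a | a \<in> out_arcs G u \<and> nb a = Y. w a) + (if X = Y then of_real (q u) else 0)" for Y
  proof -
    have arcs_XY: "{e \<in> arcs Gab. tail Gab e = X \<and> head Gab e = Y}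
        = (\<lambda>a. X \<times> {a}) ` {a. a \<in> out_arcs G u \<and> nb a = Y}"
    proof (intro equalityI subsetI)
      fix e assume e: "e \<in> {e \<in> arcs Gab. tail Gab e = X \<and> head Gab e = Y}"
      then obtain v c' a where va: "e = fibre v c' \<times> {a}" "fibre v c' \<noteq> {}" "a \<in> out_arcs G v"
        by (auto simp: arcs_Gab)
      then have "fibre v c' = X" using e by (simp add: tail_Gab)
      moreover from this have "v = u" "c' = c" using va(2) fibre_eq_iff[of v c' u c] by (auto simp: X_def)
      ultimately show "e \<in> (\<lambda>a. X \<times> {a}) ` {a. a \<in> out_arcs G u \<and> nb a = Y}"
        using va e by (auto simp: head_Gab nb_def)
    next
      fix e assume "e \<in> (\<lambda>a. X \<times> {a}) ` {a. a \<in> out_arcs G u \<and> nb a = Y}"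
      then obtain a where a: "e = X \<times> {a}" "a \<in> out_arcs G u" "nb a = Y" by blast
      have "e \<in> arcs Gab" unfolding arcs_Gab using a u ne by (auto simp: X_def)
      moreover have "tail Gab e = X" using ne by (simp add: a(1) X_def tail_Gab)
      moreover have "head Gab e = Y" using a by (simp add: X_def head_Gab nb_def)
      ultimately show "e \<in> {e \<in> arcs Gab. tail Gab e = X \<and> head Gab e = Y}" by simp
    qed
    have inj: "inj_on (\<lambda>a. X \<times> {a}) {a. a \<in> out_arcs G u \<and> nb a = Y}"
      using ne by (auto simp: inj_on_def X_def)
    have "(\<Sum>e | e \<in> arcs Gab \<and> tail Gab e = X \<and> head Gab e = Y. (w \<circ> ab_proj_arc) e)
        = (\<Sum>a | a \<in> out_arcs G u \<and> nb a = Y. w (ab_proj_arc (X \<times> {a})))"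
      unfolding arcs_XY by (subst sum.reindex[OF inj]) (simp add: comp_def)
    also have "\<dots> = (\<Sum>a | a \<in> out_arcs G u \<and> nb a = Y. w a)"
      using ne by (simp add: X_def ab_proj_arc_fibre)
    finally have "(\<Sum>e | e \<in> arcs Gab \<and> tail Gab e = X \<and> head Gab e = Y. (w \<circ> ab_proj_arc) e)
        = (\<Sum>a | a \<in> out_arcs G u \<and> nb a = Y. w a)" .
    moreover have "ab_proj_vert G v0 X = u" using ne by (simp add: X_def ab_proj_vert_fibre)
    ultimately show ?thesis
      by (auto simp: entry_def schroedinger_entry_def)
  qed
  have "schroedinger_ab G r v0 w q f X = (\<Sum>\<^sub>\<infinity>Y\<in>verts Gab. entry X Y * f Y)"
    by (simp add: schroedinger_ab_def schroedinger_op_def entry_def)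
  also have "\<dots> = (\<Sum>\<^sub>\<infinity>Y\<in>S. entry X Y * f Y)"
  proof (rule infsum_cong_neutral)
    fix Y assume "Y \<in> verts Gab - S"
    then have "{a. a \<in> out_arcs G u \<and> nb a = Y} = {}" "X \<noteq> Y" by (auto simp: S_def)
    then show "entry X Y * f Y = 0" by (simp only: entry) simp
  qed (use S in auto)
  also have "\<dots> = (\<Sum>Y\<in>S. entry X Y * f Y)" using finS by simp
  also have "\<dots> = (\<Sum>Y\<in>S. (\<Sum>a | a \<in> out_arcs G u \<and> nb a = Y. w a * f (nb a)))
      + (\<Sum>Y\<in>S. if Y = X then q u * f Y else 0)"
    unfolding sum.distrib[symmetric]
    by (rule sum.cong) (auto simp: entry distrib_right sum_distrib_right)
  also have "(\<Sum>Y\<in>S. (\<Sum>a | a \<in> out_arcs G u \<and> nb a = Y. w a * f (nb a)))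
      = (\<Sum>a\<in>out_arcs G u. w a * f (nb a))"
    using finS by (intro sum.group) (auto simp: S_def)
  also have "(\<Sum>Y\<in>S. if Y = X then q u * f Y else 0) = q u * f X"
    using finS by (simp add: S_def)
  finally show ?thesis by (simp add: X_def nb_def)
qed

text \<open>Pairs that are no vertex of the cover receive the value zero, so that the function lives on a full
  lattice and translations by arbitrary chains are available.\<close>

definition lift_to_chains ::
    "('e list set \<Rightarrow> complex) \<Rightarrow> 'v \<Rightarrow> (nat \<Rightarrow>\<^sub>0 int) \<Rightarrow> complex" where
  "lift_to_chains f v c = (if fibre v c = {} then 0 else f (fibre v c))"

text \<open>Neighbouring pairs are both vertices of the cover or both not, so the extension by zero creates no
  new terms.\<close>

lemma lift_to_chains_eigen:
  assumes eig: "\<And>X. X \<in> verts Gab \<Longrightarrow> schroedinger_ab G r v0 w q f X = l * f X"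
    and u: "u \<in> verts G"
  shows "(\<Sum>a\<in>out_arcs G u. w a * lift_to_chains f (head G a) (c + arc_chain a))
    + q u * lift_to_chains f u c = l * lift_to_chains f u c"
proof -
  have emp: "fibre (head G a) (c + arc_chain a) = {} \<longleftrightarrow> fibre u c = {}" if "a \<in> out_arcs G u" for a
    using image_extend_fibre[of a c] that by auto
  show ?thesis
  proof (cases "fibre u c = {}")
    case True
    then show ?thesis using emp by (simp add: lift_to_chains_def)
  next
    case False
    then have "fibre u c \<in> verts Gab" using u by (auto simp: verts_Gab)
    then show ?thesis
      using eig schroedinger_ab_fibre[OF u False, of w q f] False emp by (simp add: lift_to_chains_def)
  qed
qed

lemma lift_to_chains_bounded:
  assumes "square_summable_on f (verts Gab)" "finite A" "A \<subseteq> verts G \<times> UNIV"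
  shows "(\<Sum>y\<in>A. (cmod (lift_to_chains f (fst y) (snd y)))\<^sup>2)
    \<le> (\<Sum>\<^sub>\<infinity>X\<in>verts Gab. (cmod (f X))\<^sup>2)"
proof -
  define A' where "A' = {y \<in> A. fibre (fst y) (snd y) \<noteq> {}}"
  define k where "k y = fibre (fst y) (snd y)" for y
  have fin: "finite A'" using assms(2) by (simp add: A'_def)
  have "(\<Sum>y\<in>A. (cmod (lift_to_chains f (fst y) (snd y)))\<^sup>2) = (\<Sum>y\<in>A'. (cmod (f (k y)))\<^sup>2)"
    using assms(2) unfolding A'_def k_def
    by (intro sum.mono_neutral_cong_right) (auto simp: lift_to_chains_def)
  also have "\<dots> = (\<Sum>X\<in>k ` A'. (cmod (f X))\<^sup>2)"
    by (subst sum.reindex) (auto simp: inj_on_def k_def A'_def fibre_eq_iff)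
  also have "\<dots> \<le> (\<Sum>\<^sub>\<infinity>X\<in>verts Gab. (cmod (f X))\<^sup>2)"
  proof (rule finite_sum_le_infsum)
    show "k ` A' \<subseteq> verts Gab"
    proof (rule image_subsetI)
      fix y assume "y \<in> A'"
      then have "fst y \<in> verts G" "fibre (fst y) (snd y) \<noteq> {}" using assms(3) by (auto simp: A'_def)
      then show "k y \<in> verts Gab" unfolding k_def verts_Gab by blast
    qed
  qed (use assms(1) fin in \<open>auto simp: square_summable_on_def\<close>)
  finally show ?thesis .
qed

end
end

section \<open>Absence of eigenvalues\<close>

theorem theorem1p2:
  fixes G :: "('v, 'e) pre_digraph" and r :: "'e \<Rightarrow> 'e" and v0 :: 'v
    and w :: "'e \<Rightarrow> complex" and q :: "'v \<Rightarrow> real"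
  assumes "fin_digraph G" and "bidirected_digraph G r" and "Digraph_Component.connected G"
    and "v0 \<in> verts G"
    and "schroedinger_weights G r w"
    and "regular_multigraph G"
    and "\<forall>v\<in>verts G. 2 \<le> out_degree G v"
  shows "\<not> (\<exists>l. l2_eigenvalue (verts (max_abelian_cover G r v0)) (schroedinger_ab G r v0 w q) l)"
proof
  interpret fin_digraph G by fact
  interpret bidirected_digraph G r by fact
  obtain h :: "'e \<Rightarrow> nat" where h: "inj_on h (arcs G)"
    using finite_imp_inj_to_nat_seg[OF finite_arcs] by blast
  interpret weighted_multigraph G r h w q
  proof unfold_locales
    show "inj_on h (arcs G)" by fact
    fix a assume "a \<in> arcs G"
    then have "w a = cnj (w (r a))" and nz: "w a \<noteq> 0"
      using assms(5) unfolding schroedinger_weights_def by blast+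
    then show "w (r a) = cnj (w a)" by (metis complex_cnj_cnj)
    show "w a \<noteq> 0" by (rule nz)
  qed
  obtain d where d: "\<And>v. v \<in> verts G \<Longrightarrow> out_degree G v = d"
    using assms(6) by (auto simp: regular_multigraph_def)
  have "2 \<le> d" using assms(4,7) d by auto
  assume "\<exists>l. l2_eigenvalue (verts (max_abelian_cover G r v0)) (schroedinger_ab G r v0 w q) l"
  then obtain l f X where f: "square_summable_on f (verts (max_abelian_cover G r v0))"
    and X: "X \<in> verts (max_abelian_cover G r v0)" "f X \<noteq> 0"
    and eig: "\<And>X. X \<in> verts (max_abelian_cover G r v0) \<Longrightarrow> schroedinger_ab G r v0 w q f X = l * f X"
    unfolding l2_eigenvalue_def by auto
  obtain v c where v: "v \<in> verts G" "fibre v0 v c \<noteq> {}" "X = fibre v0 v c"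
    using X(1) verts_Gab[OF assms(4)] by auto
  have "lift_to_chains v0 f v c = 0"
    using d \<open>2 \<le> d\<close> lift_to_chains_bounded[OF assms(4) f] lift_to_chains_eigen[OF assms(4) eig] v(1)
    by (rule no_square_summable_eigenfunction)
  then show False using v X(2) by (simp add: lift_to_chains_def[OF assms(4)])
qed

end
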